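(* Let $(M^{2l},\omega,\nabla)$ be a Fedosov manifold admitting a metaplectic structure, with symplectic spinor bundle $\mathcal S\to M$. A symplectic spinor field $\phi\in\Gamma(M,\mathcal S)$ is a symplectic Killing spinor field if and only if $\phi$ is a symplectic Dirac spinor (i.e. an eigenfunction of the symplectic Dirac operator $\mathfrak D$) lying in the kernel of the symplectic twistor operator $\mathfrak T$.
   Context: Algebraic conventions. $(\mathbb V,\omega_0)$ is a symplectic vector space of dimension $2l$, $\mathbb V=\mathbb L\oplus\mathbb L'$ with $\mathbb L,\mathbb L'$ Lagrangian, and $\{e_i\}_{i=1}^{2l}$ is an adapted symplectic basis: $e_1,\dots,e_l\in\mathbb L$, $e_{l+1},\dots,e_{2l}\in\mathbb L'$, $\omega_0(e_i,e_{l+i})=1=-\omega_0(e_{l+i},e_i)$ for $1\le i\le l$, all other $\omega_0(e_i,e_j)=0$. $\{\epsilon^i\}$ is the dual basis, $\omega_{ij}=\omega_0(e_i,e_j)$, and $\omega^{ij}$ is defined by $\sum_k\omega_{ik}\omega^{jk}=\delta_i^j$. $G=Sp(\mathbb V,\omega_0)$, $\kappa:\tilde G\to G$ is the connected double cover (metaplectic group). ${\bf S}=L^2(\mathbb L)$ (complex valued); the symplectic Clifford multiplication $\mathbb V\times{\bf S}\to{\bf S}$ (unbounded operators) is $(e_i.f)(x)=\imath x^i f(x)$, $(e_{l+i}.f)(x)=\frac{\partial f}{\partial x^i}(x)$, $1\le i\le l$, extended linearly. $L:\tilde G\to\mathcal U({\bf S})$ is the Segal-Shale-Weil (metaplectic)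 representation, normalized so that $L(g)(v.f)=(\kappa(g)v).(L(g)f)$. Geometric conventions. A Fedosov manifold $(M,\omega,\nabla)$ is a symplectic manifold $(M,\omega)$ with a torsion-free affine connection $\nabla$ satisfying $\nabla\omega=0$. Let $p:\mathcal P\to M$ be the principal $G$-bundle of symplectic frames. A metaplectic structure is a pair $(\mathcal Q,\Lambda)$, where $\mathcal Q\to M$ is a principal $\tilde G$-bundle and $\Lambda:\mathcal Q\to\mathcal P$ is a surjective bundle homomorphism over $\mathrm{id}_M$, equivariant with respect to $\kappa$; one such structure is fixed. $\mathcal S=\mathcal Q\times_L{\bf S}$ is the symplectic spinor bundle; its sections $\Gamma(M,\mathcal S)$ (smooth $\tilde G$-equivariant maps $\mathcal Q\to{\bf S}$; these take values in the smooth vectors of $L$, i.e. Schwartz functions, on which Clifford multiplication is defined) are symplectic spinor fields. Clifford multiplication is $\tilde G$-equivariant and thus gives a multiplication $X.\phi$ of spinor fields by vector fields. $\nabla^S$ is the covariant derivative on $\mathcal S$ associated to the lift to $\mathcal Q$ of the principal connection on $\mathcal P$ determined by $\nabla$; $\nabla^S\phi$ is a section of $T^*M\otimes\mathcal S$. Killing spinors. A non-zero section $\phi\in\Gamma(M,\mathcal S)$ is a symplectic Killing spinor field if there is $\lambda\in\mathbb C$ with $\nabla^S_X\phi=\lambda X.\phi$ for every vector field $X$ on $M$. Operators. $F^+(\alpha\otimes s)=\sum_{i}\epsilon^i\wedge\alpha\otimes e_i.s$ and $F^-(\alpha\otimes s)=-\sum_{i,j}\omega^{ij}\iota_{e_i}\alpha\otimes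 e_j.s$ on $\bigwedge^\bullet\mathbb V^*\otimes{\bf S}$; they are $\tilde G$-equivariant and so act on spinor valued forms on $M$. One has the decomposition $\mathbb V^*\otimes{\bf S}={\bf E}^{10}\oplus{\bf E}^{11}$ into $\tilde G$-submodules, where ${\bf E}^{10}$ is the image of $F^+$ on ${\bf S}={\bf E}^{00}$ and ${\bf E}^{11}$ is the kernel of $F^-$ on $\mathbb V^*\otimes{\bf S}$; $p^{10}$ denotes the induced projection of spinor valued 1-forms onto the ${\bf E}^{10}$-part, and $\mathcal E^{11}$ the bundle associated to ${\bf E}^{11}$. The symplectic Dirac operator is $\mathfrak D=-F^-\nabla^S:\Gamma(M,\mathcal S)\to\Gamma(M,\mathcal S)$; its (non-zero) eigenfunctions, i.e. $\phi\neq0$ with $\mathfrak D\phi=\mu\phi$ for some $\mu\in\mathbb C$, are called symplectic Dirac spinors. The symplectic twistor operator is $\mathfrak T=\nabla^S-p^{10}\nabla^S:\Gamma(M,\mathcal S)\to\Gamma(M,\mathcal E^{11})$. *)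

theory Defs
  imports "HOL-Analysis.Analysis" "HOL-Algebra.Group"
begin

section \<open>Smoothness\<close>

fun dir_derivs ::
  "'a::real_normed_vector list \<Rightarrow> ('a \<Rightarrow> 'b::real_normed_vector) \<Rightarrow> 'a \<Rightarrow> 'b" where
  "dir_derivs [] f = f"
| "dir_derivs (v # vs) f = (\<lambda>x. frechet_derivative (dir_derivs vs f) (at x) v)"

text \<open>For open sets \<open>S\<close> and a finite-dimensional domain this is the usual class of
  infinitely differentiable functions: differentiability of all iterated directional derivatives
  includes their continuity.  The codomain may be an infinite-dimensional normed space.\<close>

definition smooth_on ::
  "'a::euclidean_space set \<Rightarrow> ('a \<Rightarrow> 'b::real_normed_vector) \<Rightarrow> bool" where
  "smooth_on S f \<longleftrightarrow> (\<forall>vs. \<forall>x\<in>S. dir_derivs vs f differentiable (at x))"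


section \<open>The Hilbert space of square integrable complex functions\<close>

definition square_integrable :: "(real^'l::finite \<Rightarrow> complex) \<Rightarrow> bool" where
  "square_integrable f \<longleftrightarrow>
     f \<in> borel_measurable borel \<and> integrable lborel (\<lambda>x. (cmod (f x))\<^sup>2)"

lemma square_integrable_zero: "square_integrable (\<lambda>x. 0)"
  by (simp add: square_integrable_def)

lemma square_integrable_scale:
  assumes "square_integrable f"
  shows "square_integrable (\<lambda>x. c * f x)"
  using assms by (auto simp: square_integrable_def norm_mult power_mult_distrib)

lemma square_integrable_scaleR:
  assumes "square_integrable f"
  shows "square_integrable (\<lambda>x. r *\<^sub>R f x)"
  using square_integrable_scale[OF assms, of "complex_of_real r"]
  by (simp add: scaleR_conv_of_real)

lemma square_integrable_add:
  assumes f: "square_integrable f" and g: "square_integrable g"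
  shows "square_integrable (\<lambda>x. f x + g x)"
proof -
  have "integrable lborel (\<lambda>x. (cmod (f x + g x))\<^sup>2)"
  proof (rule Bochner_Integration.integrable_bound)
    show "integrable lborel (\<lambda>x. 2 * (cmod (f x))\<^sup>2 + 2 * (cmod (g x))\<^sup>2)"
      using f g by (simp add: square_integrable_def)
    show "(\<lambda>x. (cmod (f x + g x))\<^sup>2) \<in> borel_measurable lborel"
      using f g by (auto simp: square_integrable_def)
    have "(cmod (f x + g x))\<^sup>2 \<le> 2 * (cmod (f x))\<^sup>2 + 2 * (cmod (g x))\<^sup>2" for x
    proof -
      have "(cmod (f x + g x))\<^sup>2 \<le> (cmod (f x) + cmod (g x))\<^sup>2"
        by (simp add: norm_triangle_ineq power_mono)
      also have "\<dots> \<le> 2 * (cmod (f x))\<^sup>2 + 2 * (cmod (g x))\<^sup>2"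
        using zero_le_power2[of "cmod (f x) - cmod (g x)"]
        by (simp add: power2_eq_square algebra_simps)
      finally show ?thesis .
    qed
    then show "AE x in lborel. norm ((cmod (f x + g x))\<^sup>2)
        \<le> norm (2 * (cmod (f x))\<^sup>2 + 2 * (cmod (g x))\<^sup>2)"
      by (intro AE_I2) simp
  qed
  then show ?thesis
    using f g by (auto simp: square_integrable_def intro: borel_measurable_add)
qed

lemma square_integrable_diff:
  assumes "square_integrable f" and "square_integrable g"
  shows "square_integrable (\<lambda>x. f x - g x)"
  using square_integrable_add[OF assms(1) square_integrable_scale[OF assms(2), of "-1"]] by simp

lemma square_integrable_inner:
  assumes f: "square_integrable f" and g: "square_integrable g"
  shows "integrable lborel (\<lambda>x. f x \<bullet> g x)"
proof (rule Bochner_Integration.integrable_bound)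
  show "integrable lborel (\<lambda>x. (cmod (f x))\<^sup>2 + (cmod (g x))\<^sup>2)"
    using f g by (simp add: square_integrable_def)
  show "(\<lambda>x. f x \<bullet> g x) \<in> borel_measurable lborel"
    using f g by (auto simp: square_integrable_def)
  have "\<bar>f x \<bullet> g x\<bar> \<le> (cmod (f x))\<^sup>2 + (cmod (g x))\<^sup>2" for x
  proof -
    have "\<bar>f x \<bullet> g x\<bar> \<le> cmod (f x) * cmod (g x)"
      by (rule Cauchy_Schwarz_ineq2)
    also have "\<dots> \<le> (cmod (f x))\<^sup>2 + (cmod (g x))\<^sup>2"
      using sum_squares_bound[of "cmod (f x)" "cmod (g x)"]
        mult_nonneg_nonneg[OF norm_ge_zero[of "f x"] norm_ge_zero[of "g x"]]
      by linarith
    finally show ?thesis .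
  qed
  then show "AE x in lborel. norm (f x \<bullet> g x) \<le> norm ((cmod (f x))\<^sup>2 + (cmod (g x))\<^sup>2)"
    by (intro AE_I2) simp
qed

quotient_type (overloaded) 'l L2 = "real^'l::finite \<Rightarrow> complex" / partial:
  "\<lambda>f g. square_integrable f \<and> square_integrable g \<and> (AE x in lborel. f x = g x)"
  morphisms rep_L2 L2_class
proof (rule part_equivpI)
  show "\<exists>f::real^'l \<Rightarrow> complex. square_integrable f \<and> square_integrable f \<and> (AE x in lborel. f x = f x)"
    by (rule exI[of _ "\<lambda>x. 0"]) (simp add: square_integrable_zero)
  show "symp (\<lambda>(f::real^'l \<Rightarrow> complex) g. square_integrable f \<and> square_integrable g \<and>
      (AE x in lborel. f x = g x))"
    by (rule sympI) auto
  show "transp (\<lambda>(f::real^'l \<Rightarrow> complex) g. square_integrable f \<and> square_integrable g \<and>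
      (AE x in lborel. f x = g x))"
    by (rule transpI) auto
qed

instantiation L2 :: (finite) real_vector
begin

lift_definition zero_L2 :: "'a L2" is "\<lambda>x. 0"
  by (simp add: square_integrable_zero)

lift_definition plus_L2 :: "'a L2 \<Rightarrow> 'a L2 \<Rightarrow> 'a L2" is "\<lambda>f g x. f x + g x"
  by (auto simp: square_integrable_add)

lift_definition uminus_L2 :: "'a L2 \<Rightarrow> 'a L2" is "\<lambda>f x. - f x"
  by (auto dest: square_integrable_scale[where c = "-1"])

lift_definition minus_L2 :: "'a L2 \<Rightarrow> 'a L2 \<Rightarrow> 'a L2" is "\<lambda>f g x. f x - g x"
  by (auto intro: square_integrable_diff)

lift_definition scaleR_L2 :: "real \<Rightarrow> 'a L2 \<Rightarrow> 'a L2" is "\<lambda>r f x. r *\<^sub>R f x"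
  by (auto simp del: scaleR_conv_of_real intro: square_integrable_scaleR)

instance
proof
  fix u v w :: "'a L2" and r s :: real
  show "u + v + w = u + (v + w)"
    by transfer (simp add: square_integrable_add add.assoc)
  show "u + v = v + u"
    by transfer (simp add: square_integrable_add add.commute)
  show "0 + u = u"
    by transfer simp
  show "- u + u = 0"
    by transfer (simp add: square_integrable_zero)
  show "u - v = u + - v"
    by transfer (simp add: square_integrable_diff)
  show "r *\<^sub>R (u + v) = r *\<^sub>R u + r *\<^sub>R v"
    by transfer (simp add: scaleR_add_right square_integrable_add square_integrable_scaleR
        del: scaleR_conv_of_real)
  show "(r + s) *\<^sub>R u = r *\<^sub>R u + s *\<^sub>R u"
    by transfer (simp add: scaleR_add_left square_integrable_add square_integrable_scaleR
        del: scaleR_conv_of_real)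
  show "r *\<^sub>R s *\<^sub>R u = (r * s) *\<^sub>R u"
    by transfer (simp add: square_integrable_scaleR del: scaleR_conv_of_real)
  show "1 *\<^sub>R u = u"
    by transfer simp
qed

end

instantiation L2 :: (finite) real_inner
begin

text \<open>The real part of the Hermitian product \<open>\<integral> f x * cnj (g x) dx\<close>.\<close>

lift_definition inner_L2 :: "'a L2 \<Rightarrow> 'a L2 \<Rightarrow> real" is "\<lambda>f g. \<integral>x. f x \<bullet> g x \<partial>lborel"
proof -
  fix f f' g g' :: "real^'a \<Rightarrow> complex"
  assume "square_integrable f \<and> square_integrable f' \<and> (AE x in lborel. f x = f' x)"
    and "square_integrable g \<and> square_integrable g' \<and> (AE x in lborel. g x = g' x)"
  moreover from this have "AE x in lborel. f x \<bullet> g x = f' x \<bullet> g' x"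
    by (auto elim: AE_mp)
  ultimately show "(\<integral>x. f x \<bullet> g x \<partial>lborel) = (\<integral>x. f' x \<bullet> g' x \<partial>lborel)"
    by (intro integral_cong_AE borel_measurable_integrable square_integrable_inner) auto
qed

definition norm_L2 :: "'a L2 \<Rightarrow> real" where
  "norm_L2 u = sqrt (u \<bullet> u)"

definition dist_L2 :: "'a L2 \<Rightarrow> 'a L2 \<Rightarrow> real" where
  "dist_L2 u v = norm (u - v)"

definition sgn_L2 :: "'a L2 \<Rightarrow> 'a L2" where
  "sgn_L2 u = u /\<^sub>R norm u"

definition uniformity_L2 :: "('a L2 \<times> 'a L2) filter" where
  "uniformity_L2 = (INF e\<in>{0 <..}. principal {(u, v). dist u v < e})"

definition open_L2 :: "'a L2 set \<Rightarrow> bool" where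
  "open_L2 U = (\<forall>x\<in>U. \<forall>\<^sub>F (x', y) in uniformity. x' = x \<longrightarrow> y \<in> U)"

instance
proof
  fix u v w :: "'a L2" and r :: real
  show "u \<bullet> v = v \<bullet> u"
    by transfer (simp add: inner_commute)
  show "(u + v) \<bullet> w = u \<bullet> w + v \<bullet> w"
    by transfer (simp add: inner_add_left square_integrable_inner)
  show "r *\<^sub>R u \<bullet> v = r * (u \<bullet> v)"
    by transfer (simp del: scaleR_conv_of_real)
  show "0 \<le> u \<bullet> u"
    by transfer simp
  show "(u \<bullet> u = 0) = (u = 0)"
  proof transfer
    fix f :: "real^'a \<Rightarrow> complex"
    assume "square_integrable f \<and> square_integrable f \<and> (AE x in lborel. f x = f x)"
    then have f: "square_integrable f" by simp
    have "((\<integral>x. f x \<bullet> f x \<partial>lborel) = 0) = (AE x in lborel. f x \<bullet> f x = 0)"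
      by (rule integral_nonneg_eq_0_iff_AE) (auto simp: square_integrable_inner f)
    then show "((\<integral>x. f x \<bullet> f x \<partial>lborel) = 0) =
        (square_integrable f \<and> square_integrable (\<lambda>x::real^'a. 0) \<and> (AE x in lborel. f x = 0))"
      by (simp add: f square_integrable_zero)
  qed
  show "norm u = sqrt (u \<bullet> u)"
    by (simp add: norm_L2_def)
  show "dist u v = norm (u - v)"
    by (simp add: dist_L2_def)
  show "sgn u = u /\<^sub>R norm u"
    by (simp add: sgn_L2_def)
  show "uniformity = (INF e\<in>{0 <..}. principal {(u, v :: 'a L2). dist u v < e})"
    by (simp add: uniformity_L2_def)
  show "open U = (\<forall>x\<in>U. \<forall>\<^sub>F (x', y) in uniformity. x' = x \<longrightarrow> y \<in> U)" for U :: "'a L2 set"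
    by (simp add: open_L2_def)
qed

end

lift_definition scaleC_L2 :: "complex \<Rightarrow> 'l::finite L2 \<Rightarrow> 'l L2"  (infixr \<open>*\<^sub>C\<close> 75)
  is "\<lambda>c f x. c * f x"
  by (auto intro: square_integrable_scale)

definition schwartz :: "(real^'l::finite \<Rightarrow> complex) \<Rightarrow> bool" where
  "schwartz f \<longleftrightarrow> smooth_on UNIV f \<and>
     (\<forall>k vs. bounded (range (\<lambda>x. norm x ^ k *\<^sub>R dir_derivs vs f x)))"

definition schwartz_space :: "'l::finite L2 set" where
  "schwartz_space = {L2_class f | f. schwartz f}"

text \<open>Continuous functions that agree almost everywhere are equal, so the Schwartz function
  representing a class is unique.\<close>

definition schwartz_rep :: "'l::finite L2 \<Rightarrow> real^'l \<Rightarrow> complex" where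
  "schwartz_rep u = (THE f. schwartz f \<and> L2_class f = u)"


section \<open>The symplectic vector space and symplectic Clifford multiplication\<close>

text \<open>The symplectic vector space of dimension \<open>2l\<close> is \<open>real^('l+'l)\<close>, identified through the
  adapted basis: with \<open>l = CARD('l)\<close>, the vector \<open>e\<^sub>i\<close> is \<open>axis (Inl i) 1\<close> and
  \<open>e\<^bsub>l+i\<^esub>\<close> is \<open>axis (Inr i) 1\<close>; the Lagrangian subspace \<open>\<bbbL>\<close> is \<open>real^'l\<close>.\<close>

definition omega0 :: "real^('l::finite + 'l) \<Rightarrow> real^('l + 'l) \<Rightarrow> real" where
  "omega0 v w = (\<Sum>i\<in>UNIV. v $ Inl i * w $ Inr i - v $ Inr i * w $ Inl i)"

definition omega_lo :: "real^('l::finite + 'l)^('l + 'l)" where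
  "omega_lo = (\<chi> i j. omega0 (axis i 1) (axis j 1))"

text \<open>The matrix \<open>\<omega>\<^sup>i\<^sup>j\<close> determined by \<open>\<Sum>k. \<omega>\<^sub>i\<^sub>k \<omega>\<^sup>j\<^sup>k = \<delta>\<^sub>i\<^sup>j\<close>; see \<open>omega_up\<close> below.\<close>

definition omega_up :: "real^('l::finite + 'l)^('l + 'l)" where
  "omega_up = transpose (matrix_inv omega_lo)"

lemma sum_UNIV_Plus:
  fixes f :: "'a::finite + 'b::finite \<Rightarrow> 'c::comm_monoid_add"
  shows "(\<Sum>k\<in>UNIV. f k) = (\<Sum>k\<in>UNIV. f (Inl k)) + (\<Sum>k\<in>UNIV. f (Inr k))"
  unfolding UNIV_Plus_UNIV[symmetric] by (subst sum.Plus) auto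

lemma omega_lo_entries:
  "omega_lo $ Inl i $ Inl j = 0"
  "omega_lo $ Inr i $ Inr j = 0"
  "omega_lo $ Inl i $ Inr j = (if i = j then 1 else 0)"
  "omega_lo $ Inr i $ Inl j = (if i = j then -1 else 0)"
  by (auto simp: omega_lo_def omega0_def axis_def if_distrib[of "\<lambda>x. x * _"] sum.If_cases
      sum_negf cong: if_cong)

lemma omega_up:
  fixes i j :: "'l::finite + 'l"
  shows "(\<Sum>k\<in>UNIV. omega_lo $ i $ k * omega_up $ j $ k) = (if i = j then 1 else 0)"
proof -
  have "omega_lo ** transpose omega_lo = (mat 1 :: real^('l + 'l)^('l + 'l))"
  proof -
    have "(omega_lo ** transpose omega_lo) $ i $ j = (mat 1 :: real^('l + 'l)^('l + 'l)) $ i $ j"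
      for i j
      by (cases i; cases j) (auto simp: matrix_matrix_mult_def transpose_def mat_def
          sum_UNIV_Plus omega_lo_entries if_distrib[of "\<lambda>x. x * _"] if_distrib[of "\<lambda>x. _ * x"]
          cong: if_cong)
    then show ?thesis by (simp add: vec_eq_iff)
  qed
  then have "invertible (omega_lo :: real^('l + 'l)^('l + 'l))"
    using invertible_right_inverse by blast
  then have "omega_lo ** matrix_inv omega_lo = (mat 1 :: real^('l + 'l)^('l + 'l))"
    unfolding invertible_def matrix_inv_def by (rule someI2_ex) blast
  then have "(omega_lo ** matrix_inv omega_lo) $ i $ j = (mat 1 :: real^('l + 'l)^('l + 'l)) $ i $ j"
    by simp
  then show ?thesis
    by (simp add: omega_up_def matrix_matrix_mult_def transpose_def mat_def)
qed

text \<open>The multiplication operators are unbounded; their domain is the Schwartz space, and values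
  at other elements of \<open>'l L2\<close> carry no meaning.\<close>

primrec clifford_basis :: "'l::finite + 'l \<Rightarrow> 'l L2 \<Rightarrow> 'l L2" where
  "clifford_basis (Inl i) u = L2_class (\<lambda>x. \<i> * of_real (x $ i) * schwartz_rep u x)"
| "clifford_basis (Inr i) u =
     L2_class (\<lambda>x. frechet_derivative (schwartz_rep u) (at x) (axis i 1))"

definition clifford :: "real^('l::finite + 'l) \<Rightarrow> 'l L2 \<Rightarrow> 'l L2" where
  "clifford v u = (\<Sum>i\<in>UNIV. v $ i *\<^sub>R clifford_basis i u)"

text \<open>An element \<open>\<Sum>i. \<epsilon>\<^sup>i \<otimes> s\<^sub>i\<close> of \<open>\<bbbV>\<^sup>* \<otimes> S\<close> is the vector of its components
  \<open>s\<^sub>i\<close>.  Of the operators on spinor valued forms only \<open>F\<^sup>+\<close> in degree 0 and \<open>F\<^sup>-\<close> in degree 1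
  occur; there \<open>\<epsilon>\<^sup>i \<and> 1 = \<epsilon>\<^sup>i\<close> and the contraction of \<open>\<epsilon>\<^sup>k\<close> with \<open>e\<^sub>i\<close> is \<open>\<delta>\<^sub>i\<^sup>k\<close>.\<close>

definition F_plus :: "'l::finite L2 \<Rightarrow> 'l L2^('l + 'l)" where
  "F_plus s = (\<chi> i. clifford (axis i 1) s)"

definition F_minus :: "'l::finite L2^('l + 'l) \<Rightarrow> 'l L2" where
  "F_minus \<alpha> = - (\<Sum>i\<in>UNIV. \<Sum>j\<in>UNIV. omega_up $ i $ j *\<^sub>R clifford (axis j 1) (\<alpha> $ i))"

definition schwartz_forms :: "('l::finite L2^('l + 'l)) set" where
  "schwartz_forms = {\<alpha>. \<forall>i. \<alpha> $ i \<in> schwartz_space}"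

definition E10 :: "('l::finite L2^('l + 'l)) set" where
  "E10 = F_plus ` schwartz_space"

definition E11 :: "('l::finite L2^('l + 'l)) set" where
  "E11 = {\<alpha> \<in> schwartz_forms. F_minus \<alpha> = 0}"

text \<open>The projection onto \<open>E10\<close> along \<open>E11\<close>, set to \<open>0\<close> outside its domain
  \<open>E10 \<oplus> E11 = schwartz_forms\<close>.\<close>

definition p10 :: "'l::finite L2^('l + 'l) \<Rightarrow> 'l L2^('l + 'l)" where
  "p10 \<alpha> = (if \<alpha> \<in> schwartz_forms then (THE \<beta>. \<beta> \<in> E10 \<and> \<alpha> - \<beta> \<in> E11) else 0)"


section \<open>Smooth manifolds\<close>

text \<open>A manifold is a topological space (a whole type) with a smooth atlas; a chart is a pair of
  its domain and its coordinate map, which is irrelevant outside the domain.\<close>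

type_synonym ('m, 'e) chart = "'m set \<times> ('m \<Rightarrow> 'e)"

definition chart_inv :: "('m, 'e) chart \<Rightarrow> 'e \<Rightarrow> 'm" where
  "chart_inv c = inv_into (fst c) (snd c)"

definition smooth_manifold ::
  "('m::{t2_space, second_countable_topology}, 'e::euclidean_space) chart set \<Rightarrow> bool" where
  "smooth_manifold A \<longleftrightarrow>
     (\<forall>c\<in>A. open (fst c) \<and> open (snd c ` fst c) \<and>
        (\<exists>g. homeomorphism (fst c) (snd c ` fst c) (snd c) g)) \<and>
     (\<Union>c\<in>A. fst c) = UNIV \<and>
     (\<forall>c\<in>A. \<forall>d\<in>A. smooth_on (snd c ` (fst c \<inter> fst d)) (snd d \<circ> chart_inv c))"

definition product_atlas ::
  "('m, 'e) chart set \<Rightarrow> ('n, 'f) chart set \<Rightarrow> ('m \<times> 'n, 'e \<times> 'f) chart set" where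
  "product_atlas A B = {(fst c \<times> fst d, map_prod (snd c) (snd d)) | c d. c \<in> A \<and> d \<in> B}"

text \<open>Smooth maps into another manifold, defined on the open set \<open>W\<close>.\<close>

definition smooth_map ::
  "('m::topological_space, 'e::euclidean_space) chart set \<Rightarrow>
   ('n::topological_space, 'f::euclidean_space) chart set \<Rightarrow> 'm set \<Rightarrow> ('m \<Rightarrow> 'n) \<Rightarrow> bool" where
  "smooth_map A B W h \<longleftrightarrow> continuous_on W h \<and>
     (\<forall>c\<in>A. \<forall>d\<in>B. smooth_on (snd c ` (fst c \<inter> W \<inter> h -` fst d)) (snd d \<circ> h \<circ> chart_inv c))"

text \<open>Smooth maps into a normed space, defined on the open set \<open>W\<close>.\<close>

definition smooth_fun ::
  "('m, 'e::euclidean_space) chart set \<Rightarrow> 'm set \<Rightarrow> ('m \<Rightarrow> 'b::real_normed_vector) \<Rightarrow> bool" where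
  "smooth_fun A W f \<longleftrightarrow> (\<forall>c\<in>A. smooth_on (snd c ` (fst c \<inter> W)) (f \<circ> chart_inv c))"

text \<open>The tangent space at every point \<open>x\<close> is a copy of the model space \<open>'e\<close>: a tangent vector at
  \<open>x\<close> is given by its coordinates in the chart \<open>chart_at A x\<close> chosen at \<open>x\<close>.  All other notions
  account for the change of charts, so nothing below depends on the choice.\<close>

definition chart_at :: "('m, 'e) chart set \<Rightarrow> 'm \<Rightarrow> ('m, 'e) chart" where
  "chart_at A x = (SOME c. c \<in> A \<and> x \<in> fst c)"

text \<open>The differential at \<open>x\<close>, applied to the tangent vector \<open>v\<close>, of a map into a normed space
  that is defined near \<open>x\<close>.\<close>

definition differential ::
  "('m, 'e::euclidean_space) chart set \<Rightarrow> ('m \<Rightarrow> 'b::real_normed_vector) \<Rightarrow> 'm \<Rightarrow> 'e \<Rightarrow> 'b" where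
  "differential A f x v =
     frechet_derivative (f \<circ> chart_inv (chart_at A x)) (at (snd (chart_at A x) x)) v"

definition tangent_map ::
  "('m, 'e::euclidean_space) chart set \<Rightarrow> ('n, 'f::euclidean_space) chart set \<Rightarrow> ('m \<Rightarrow> 'n) \<Rightarrow>
   'm \<Rightarrow> 'e \<Rightarrow> 'f" where
  "tangent_map A B h x v = differential A (snd (chart_at B (h x)) \<circ> h) x v"

text \<open>Vector fields are smooth if their coordinates \<open>differential A (snd c) y (X y)\<close> in every
  chart \<open>c\<close> of the atlas are.\<close>

definition vector_fields :: "('m, 'e::euclidean_space) chart set \<Rightarrow> ('m \<Rightarrow> 'e) set" where
  "vector_fields A =
     {X. \<forall>c\<in>A. smooth_fun A (fst c) (\<lambda>y. differential A (snd c) y (X y))}"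

definition lie_derivative ::
  "('m, 'e::euclidean_space) chart set \<Rightarrow> ('m \<Rightarrow> 'e) \<Rightarrow> ('m \<Rightarrow> real) \<Rightarrow> 'm \<Rightarrow> real" where
  "lie_derivative A X f = (\<lambda>x. differential A f x (X x))"

definition lie_bracket ::
  "('m, 'e::euclidean_space) chart set \<Rightarrow> ('m \<Rightarrow> 'e) \<Rightarrow> ('m \<Rightarrow> 'e) \<Rightarrow> 'm \<Rightarrow> 'e" where
  "lie_bracket A X Y = (\<lambda>x. THE v. \<forall>f. smooth_fun A UNIV f \<longrightarrow>
     differential A f x v =
       lie_derivative A X (lie_derivative A Y f) x - lie_derivative A Y (lie_derivative A X f) x)"


section \<open>Fedosov manifolds\<close>

definition symplectic_manifold ::
  "('m::{t2_space, second_countable_topology}, real^('l::finite + 'l)) chart set \<Rightarrow>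
   ('m \<Rightarrow> real^('l + 'l) \<Rightarrow> real^('l + 'l) \<Rightarrow> real) \<Rightarrow> bool" where
  "symplectic_manifold A \<omega> \<longleftrightarrow> smooth_manifold A \<and>
     (\<forall>x. bilinear (\<omega> x) \<and> (\<forall>v. \<omega> x v v = 0) \<and> (\<forall>v. (\<forall>w. \<omega> x v w = 0) \<longrightarrow> v = 0)) \<and>
     (\<forall>X\<in>vector_fields A. \<forall>Y\<in>vector_fields A. smooth_fun A UNIV (\<lambda>x. \<omega> x (X x) (Y x))) \<and>
     (\<forall>X\<in>vector_fields A. \<forall>Y\<in>vector_fields A. \<forall>Z\<in>vector_fields A. \<forall>x.
        lie_derivative A X (\<lambda>y. \<omega> y (Y y) (Z y)) x
      - lie_derivative A Y (\<lambda>y. \<omega> y (X y) (Z y)) x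
      + lie_derivative A Z (\<lambda>y. \<omega> y (X y) (Y y)) x
      - \<omega> x (lie_bracket A X Y x) (Z x)
      + \<omega> x (lie_bracket A X Z x) (Y x)
      - \<omega> x (lie_bracket A Y Z x) (X x) = 0)"

definition affine_connection ::
  "('m, 'e::euclidean_space) chart set \<Rightarrow> (('m \<Rightarrow> 'e) \<Rightarrow> ('m \<Rightarrow> 'e) \<Rightarrow> 'm \<Rightarrow> 'e) \<Rightarrow> bool" where
  "affine_connection A nabla \<longleftrightarrow>
     (\<forall>X\<in>vector_fields A. \<forall>Y\<in>vector_fields A.
        nabla X Y \<in> vector_fields A \<and>
        (\<forall>Z\<in>vector_fields A. \<forall>x.
           nabla (\<lambda>y. X y + Z y) Y x = nabla X Y x + nabla Z Y x \<and>
           nabla X (\<lambda>y. Y y + Z y) x = nabla X Y x + nabla X Z x) \<and>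
        (\<forall>f. smooth_fun A UNIV f \<longrightarrow> (\<forall>x.
           nabla (\<lambda>y. f y *\<^sub>R X y) Y x = f x *\<^sub>R nabla X Y x \<and>
           nabla X (\<lambda>y. f y *\<^sub>R Y y) x
             = lie_derivative A X f x *\<^sub>R Y x + f x *\<^sub>R nabla X Y x)))"

definition torsion_free ::
  "('m, 'e::euclidean_space) chart set \<Rightarrow> (('m \<Rightarrow> 'e) \<Rightarrow> ('m \<Rightarrow> 'e) \<Rightarrow> 'm \<Rightarrow> 'e) \<Rightarrow> bool" where
  "torsion_free A nabla \<longleftrightarrow>
     (\<forall>X\<in>vector_fields A. \<forall>Y\<in>vector_fields A. \<forall>x.
        nabla X Y x - nabla Y X x = lie_bracket A X Y x)"

definition fedosov_manifold ::
  "('m::{t2_space, second_countable_topology}, real^('l::finite + 'l)) chart set \<Rightarrow>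
   ('m \<Rightarrow> real^('l + 'l) \<Rightarrow> real^('l + 'l) \<Rightarrow> real) \<Rightarrow>
   (('m \<Rightarrow> real^('l + 'l)) \<Rightarrow> ('m \<Rightarrow> real^('l + 'l)) \<Rightarrow> 'm \<Rightarrow> real^('l + 'l)) \<Rightarrow> bool" where
  "fedosov_manifold A \<omega> nabla \<longleftrightarrow>
     symplectic_manifold A \<omega> \<and> affine_connection A nabla \<and> torsion_free A nabla \<and>
     (\<forall>X\<in>vector_fields A. \<forall>Y\<in>vector_fields A. \<forall>Z\<in>vector_fields A. \<forall>x.
        lie_derivative A X (\<lambda>y. \<omega> y (Y y) (Z y)) x
          = \<omega> x (nabla X Y x) (Z x) + \<omega> x (Y x) (nabla X Z x))"


section \<open>The metaplectic group and the Segal-Shale-Weil representation\<close>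

definition symplectic_group :: "(real^('l::finite + 'l)^('l + 'l)) set" where
  "symplectic_group = {g. \<forall>v w. omega0 (g *v v) (g *v w) = omega0 v w}"

definition lie_group ::
  "'g monoid \<Rightarrow> ('g::{t2_space, second_countable_topology}, 'h::euclidean_space) chart set \<Rightarrow> bool"
  where
  "lie_group G AG \<longleftrightarrow> smooth_manifold AG \<and> group G \<and> carrier G = UNIV \<and>
     smooth_map (product_atlas AG AG) AG UNIV (\<lambda>(g, h). g \<otimes>\<^bsub>G\<^esub> h) \<and>
     smooth_map AG AG UNIV (m_inv G)"

definition metaplectic_group ::
  "'g monoid \<Rightarrow> ('g::{t2_space, second_countable_topology}, 'h::euclidean_space) chart set \<Rightarrow>
   ('g \<Rightarrow> real^('l::finite + 'l)^('l + 'l)) \<Rightarrow> bool" where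
  "metaplectic_group G AG \<kappa> \<longleftrightarrow> lie_group G AG \<and> connected (UNIV :: 'g set) \<and>
     smooth_fun AG UNIV \<kappa> \<and> (\<forall>g h. \<kappa> (g \<otimes>\<^bsub>G\<^esub> h) = \<kappa> g ** \<kappa> h) \<and>
     covering_space UNIV \<kappa> symplectic_group \<and>
     (\<forall>a\<in>symplectic_group. card {g. \<kappa> g = a} = 2)"

definition unitary_L2 :: "('l::finite L2 \<Rightarrow> 'l L2) \<Rightarrow> bool" where
  "unitary_L2 U \<longleftrightarrow> (\<forall>u v. U (u + v) = U u + U v) \<and> (\<forall>c u. U (c *\<^sub>C u) = c *\<^sub>C U u) \<and>
     (\<forall>u. norm (U u) = norm u) \<and> surj U"

text \<open>The Segal-Shale-Weil representation is the unique strongly continuous unitary representation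
  of the metaplectic group with the stated equivariance: by irreducibility of the canonical
  commutation relations two such representations differ by a character of the group, and the
  metaplectic group is perfect.\<close>

definition segal_shale_weil ::
  "'g::topological_space monoid \<Rightarrow> ('g \<Rightarrow> real^('l::finite + 'l)^('l + 'l)) \<Rightarrow>
   ('g \<Rightarrow> 'l L2 \<Rightarrow> 'l L2) \<Rightarrow> bool" where
  "segal_shale_weil G \<kappa> L \<longleftrightarrow>
     (\<forall>g. unitary_L2 (L g)) \<and> (\<forall>g h. L (g \<otimes>\<^bsub>G\<^esub> h) = L g \<circ> L h) \<and>
     (\<forall>u. continuous_on UNIV (\<lambda>g. L g u)) \<and>
     (\<forall>g. \<forall>u\<in>schwartz_space. L g u \<in> schwartz_space \<and>
        (\<forall>v. L g (clifford v u) = clifford (\<kappa> g *v v) (L g u)))"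


section \<open>Metaplectic structures\<close>

text \<open>A symplectic frame at \<open>x\<close> is a symplectic linear map from \<open>\<bbbV>\<close> to the tangent space at
  \<open>x\<close>; the symplectic group acts on the right by composition.\<close>

definition symplectic_frames ::
  "('m \<Rightarrow> real^('l::finite + 'l) \<Rightarrow> real^('l + 'l) \<Rightarrow> real) \<Rightarrow>
   ('m \<times> (real^('l + 'l)^('l + 'l))) set" where
  "symplectic_frames \<omega> = {(x, u). \<forall>v w. \<omega> x (u *v v) (u *v w) = omega0 v w}"

definition principal_bundle ::
  "('m::{t2_space, second_countable_topology}, 'e::euclidean_space) chart set \<Rightarrow>
   'g monoid \<Rightarrow> ('g::{t2_space, second_countable_topology}, 'h::euclidean_space) chart set \<Rightarrow>
   ('q::{t2_space, second_countable_topology}, 'k::euclidean_space) chart set \<Rightarrow>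
   ('q \<Rightarrow> 'm) \<Rightarrow> ('q \<Rightarrow> 'g \<Rightarrow> 'q) \<Rightarrow> bool" where
  "principal_bundle A G AG AQ proj act \<longleftrightarrow>
     smooth_manifold A \<and> lie_group G AG \<and> smooth_manifold AQ \<and>
     smooth_map AQ A UNIV proj \<and>
     smooth_map (product_atlas AQ AG) AQ UNIV (\<lambda>(q, g). act q g) \<and>
     (\<forall>q. act q \<one>\<^bsub>G\<^esub> = q) \<and> (\<forall>q g h. act (act q g) h = act q (g \<otimes>\<^bsub>G\<^esub> h)) \<and>
     (\<forall>x. \<exists>U \<Phi> \<Psi>. open U \<and> x \<in> U \<and>
        homeomorphism (U \<times> UNIV) (proj -` U) \<Phi> \<Psi> \<and>
        smooth_map (product_atlas A AG) AQ (U \<times> UNIV) \<Phi> \<and>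
        smooth_map AQ (product_atlas A AG) (proj -` U) \<Psi> \<and>
        (\<forall>y\<in>U. \<forall>g h. proj (\<Phi> (y, g)) = y \<and> \<Phi> (y, g \<otimes>\<^bsub>G\<^esub> h) = act (\<Phi> (y, g)) h))"

text \<open>Smoothness of \<open>Lam\<close> as a map into the frame bundle means smoothness of the coordinates of
  the frame vectors in every chart of the base.\<close>

definition metaplectic_structure ::
  "('m::{t2_space, second_countable_topology}, real^('l::finite + 'l)) chart set \<Rightarrow>
   ('m \<Rightarrow> real^('l + 'l) \<Rightarrow> real^('l + 'l) \<Rightarrow> real) \<Rightarrow>
   'g monoid \<Rightarrow> ('g::{t2_space, second_countable_topology}, 'h::euclidean_space) chart set \<Rightarrow>
   ('g \<Rightarrow> real^('l + 'l)^('l + 'l)) \<Rightarrow>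
   ('q::{t2_space, second_countable_topology}, 'k::euclidean_space) chart set \<Rightarrow>
   ('q \<Rightarrow> 'm) \<Rightarrow> ('q \<Rightarrow> 'g \<Rightarrow> 'q) \<Rightarrow> ('q \<Rightarrow> 'm \<times> (real^('l + 'l)^('l + 'l))) \<Rightarrow> bool" where
  "metaplectic_structure A \<omega> G AG \<kappa> AQ proj act Lam \<longleftrightarrow>
     principal_bundle A G AG AQ proj act \<and>
     range Lam = symplectic_frames \<omega> \<and> (\<forall>q. fst (Lam q) = proj q) \<and>
     (\<forall>q g. snd (Lam (act q g)) = snd (Lam q) ** \<kappa> g) \<and>
     (\<forall>c\<in>A. \<forall>v. smooth_fun AQ (proj -` fst c)
        (\<lambda>q. differential A (snd c) (proj q) (snd (Lam q) *v v)))"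


section \<open>Symplectic spinor fields and their covariant derivative\<close>

text \<open>A smooth equivariant map takes values in the smooth vectors of the representation, which are
  the Schwartz functions; this is stated as an explicit clause.\<close>

definition spinor_fields ::
  "'g monoid \<Rightarrow> ('g \<Rightarrow> 'l::finite L2 \<Rightarrow> 'l L2) \<Rightarrow>
   ('q, 'k::euclidean_space) chart set \<Rightarrow> ('q \<Rightarrow> 'g \<Rightarrow> 'q) \<Rightarrow> ('q \<Rightarrow> 'l L2) set" where
  "spinor_fields G L AQ act = {\<phi>. smooth_fun AQ UNIV \<phi> \<and>
     (\<forall>q g. \<phi> (act q g) = L (m_inv G g) (\<phi> q)) \<and> (\<forall>q. \<phi> q \<in> schwartz_space)}"

text \<open>A vector field \<open>Y\<close>, viewed as the equivariant function \<open>q \<mapsto> \<Lambda>(q)\<^sup>-\<^sup>1 Y\<close> with values in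
  \<open>\<bbbV>\<close>.\<close>

definition frame_coords ::
  "('q \<Rightarrow> 'm) \<Rightarrow> ('q \<Rightarrow> 'm \<times> (real^('l::finite + 'l)^('l + 'l))) \<Rightarrow> ('m \<Rightarrow> real^('l + 'l)) \<Rightarrow>
   'q \<Rightarrow> real^('l + 'l)" where
  "frame_coords proj Lam Y = (\<lambda>q. matrix_inv (snd (Lam q)) *v Y (proj q))"

text \<open>The standard horizontal vector fields on \<open>\<Q>\<close> of the lifted connection: at \<open>q\<close>, the horizontal
  lift of the tangent vector \<open>\<Lambda>(q) v\<close>.  The principal connection determined by \<open>nabla\<close> is the one
  for which the equivariant function of \<open>nabla X Y\<close> is the derivative of the equivariant function
  of \<open>Y\<close> along the horizontal lift of \<open>X\<close>; together with the projection to the base this determines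
  the horizontal lift.\<close>

definition horizontal_lift ::
  "('m, real^('l::finite + 'l)) chart set \<Rightarrow>
   (('m \<Rightarrow> real^('l + 'l)) \<Rightarrow> ('m \<Rightarrow> real^('l + 'l)) \<Rightarrow> 'm \<Rightarrow> real^('l + 'l)) \<Rightarrow>
   ('q, 'k::euclidean_space) chart set \<Rightarrow> ('q \<Rightarrow> 'm) \<Rightarrow>
   ('q \<Rightarrow> 'm \<times> (real^('l + 'l)^('l + 'l))) \<Rightarrow> 'q \<Rightarrow> real^('l + 'l) \<Rightarrow> 'k" where
  "horizontal_lift A nabla AQ proj Lam q v =
     (THE \<xi>. tangent_map AQ A proj q \<xi> = snd (Lam q) *v v \<and>
        (\<forall>X\<in>vector_fields A. \<forall>Y\<in>vector_fields A. X (proj q) = snd (Lam q) *v v \<longrightarrow>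
           differential AQ (frame_coords proj Lam Y) q \<xi> = frame_coords proj Lam (nabla X Y) q))"

text \<open>The section \<open>\<nabla>\<^sup>S \<phi>\<close> of \<open>T\<^sup>*M \<otimes> \<S>\<close>, as an equivariant function with values in \<open>\<bbbV>\<^sup>* \<otimes> S\<close>.\<close>

definition spinor_derivative ::
  "('m, real^('l::finite + 'l)) chart set \<Rightarrow>
   (('m \<Rightarrow> real^('l + 'l)) \<Rightarrow> ('m \<Rightarrow> real^('l + 'l)) \<Rightarrow> 'm \<Rightarrow> real^('l + 'l)) \<Rightarrow>
   ('q, 'k::euclidean_space) chart set \<Rightarrow> ('q \<Rightarrow> 'm) \<Rightarrow>
   ('q \<Rightarrow> 'm \<times> (real^('l + 'l)^('l + 'l))) \<Rightarrow> ('q \<Rightarrow> 'l L2) \<Rightarrow> 'q \<Rightarrow> 'l L2^('l + 'l)" where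
  "spinor_derivative A nabla AQ proj Lam \<phi> = (\<lambda>q. \<chi> i.
     differential AQ \<phi> q (horizontal_lift A nabla AQ proj Lam q (axis i 1)))"

definition covariant_derivative ::
  "('m, real^('l::finite + 'l)) chart set \<Rightarrow>
   (('m \<Rightarrow> real^('l + 'l)) \<Rightarrow> ('m \<Rightarrow> real^('l + 'l)) \<Rightarrow> 'm \<Rightarrow> real^('l + 'l)) \<Rightarrow>
   ('q, 'k::euclidean_space) chart set \<Rightarrow> ('q \<Rightarrow> 'm) \<Rightarrow>
   ('q \<Rightarrow> 'm \<times> (real^('l + 'l)^('l + 'l))) \<Rightarrow> ('m \<Rightarrow> real^('l + 'l)) \<Rightarrow> ('q \<Rightarrow> 'l L2) \<Rightarrow>
   'q \<Rightarrow> 'l L2" where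
  "covariant_derivative A nabla AQ proj Lam X \<phi> = (\<lambda>q.
     \<Sum>i\<in>UNIV. frame_coords proj Lam X q $ i *\<^sub>R spinor_derivative A nabla AQ proj Lam \<phi> q $ i)"

definition clifford_field ::
  "('q \<Rightarrow> 'm) \<Rightarrow> ('q \<Rightarrow> 'm \<times> (real^('l::finite + 'l)^('l + 'l))) \<Rightarrow>
   ('m \<Rightarrow> real^('l + 'l)) \<Rightarrow> ('q \<Rightarrow> 'l L2) \<Rightarrow> 'q \<Rightarrow> 'l L2" where
  "clifford_field proj Lam X \<phi> = (\<lambda>q. clifford (frame_coords proj Lam X q) (\<phi> q))"

definition symplectic_dirac ::
  "('m, real^('l::finite + 'l)) chart set \<Rightarrow>
   (('m \<Rightarrow> real^('l + 'l)) \<Rightarrow> ('m \<Rightarrow> real^('l + 'l)) \<Rightarrow> 'm \<Rightarrow> real^('l + 'l)) \<Rightarrow>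
   ('q, 'k::euclidean_space) chart set \<Rightarrow> ('q \<Rightarrow> 'm) \<Rightarrow>
   ('q \<Rightarrow> 'm \<times> (real^('l + 'l)^('l + 'l))) \<Rightarrow> ('q \<Rightarrow> 'l L2) \<Rightarrow> 'q \<Rightarrow> 'l L2" where
  "symplectic_dirac A nabla AQ proj Lam \<phi> =
     (\<lambda>q. - F_minus (spinor_derivative A nabla AQ proj Lam \<phi> q))"

definition symplectic_twistor ::
  "('m, real^('l::finite + 'l)) chart set \<Rightarrow>
   (('m \<Rightarrow> real^('l + 'l)) \<Rightarrow> ('m \<Rightarrow> real^('l + 'l)) \<Rightarrow> 'm \<Rightarrow> real^('l + 'l)) \<Rightarrow>
   ('q, 'k::euclidean_space) chart set \<Rightarrow> ('q \<Rightarrow> 'm) \<Rightarrow>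
   ('q \<Rightarrow> 'm \<times> (real^('l + 'l)^('l + 'l))) \<Rightarrow> ('q \<Rightarrow> 'l L2) \<Rightarrow> 'q \<Rightarrow> 'l L2^('l + 'l)" where
  "symplectic_twistor A nabla AQ proj Lam \<phi> =
     (\<lambda>q. spinor_derivative A nabla AQ proj Lam \<phi> q
        - p10 (spinor_derivative A nabla AQ proj Lam \<phi> q))"

definition symplectic_killing_spinor ::
  "('m, real^('l::finite + 'l)) chart set \<Rightarrow>
   (('m \<Rightarrow> real^('l + 'l)) \<Rightarrow> ('m \<Rightarrow> real^('l + 'l)) \<Rightarrow> 'm \<Rightarrow> real^('l + 'l)) \<Rightarrow>
   ('q, 'k::euclidean_space) chart set \<Rightarrow> ('q \<Rightarrow> 'm) \<Rightarrow>
   ('q \<Rightarrow> 'm \<times> (real^('l + 'l)^('l + 'l))) \<Rightarrow> ('q \<Rightarrow> 'l L2) \<Rightarrow> bool" where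
  "symplectic_killing_spinor A nabla AQ proj Lam \<phi> \<longleftrightarrow> \<phi> \<noteq> (\<lambda>q. 0) \<and>
     (\<exists>c. \<forall>X\<in>vector_fields A. covariant_derivative A nabla AQ proj Lam X \<phi>
        = (\<lambda>q. c *\<^sub>C clifford_field proj Lam X \<phi> q))"

definition symplectic_dirac_spinor ::
  "('m, real^('l::finite + 'l)) chart set \<Rightarrow>
   (('m \<Rightarrow> real^('l + 'l)) \<Rightarrow> ('m \<Rightarrow> real^('l + 'l)) \<Rightarrow> 'm \<Rightarrow> real^('l + 'l)) \<Rightarrow>
   ('q, 'k::euclidean_space) chart set \<Rightarrow> ('q \<Rightarrow> 'm) \<Rightarrow>
   ('q \<Rightarrow> 'm \<times> (real^('l + 'l)^('l + 'l))) \<Rightarrow> ('q \<Rightarrow> 'l L2) \<Rightarrow> bool" where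
  "symplectic_dirac_spinor A nabla AQ proj Lam \<phi> \<longleftrightarrow> \<phi> \<noteq> (\<lambda>q. 0) \<and>
     (\<exists>\<mu>. symplectic_dirac A nabla AQ proj Lam \<phi> = (\<lambda>q. \<mu> *\<^sub>C \<phi> q))"

end

theory Submission
  imports Defs "HOL-Probability.Sinc_Integral"
begin

text \<open>On Schwartz functions the canonical commutation relations give \<open>F\<^sup>- F\<^sup>+ = - \<i> l\<close>, so that
  \<open>p\<^sup>1\<^sup>0 = F\<^sup>+ (\<i> / l) F\<^sup>-\<close>.  The covariant derivative of \<open>\<phi>\<close>, as a function on \<open>\<Q>\<close> with values in
  \<open>\<bbbV>\<^sup>* \<otimes> S\<close>, satisfies the Killing equation if and only if it equals \<open>F\<^sup>+ (\<lambda> \<phi>)\<close>; one direction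
  needs a vector field with a prescribed value at a point, which a bump function provides.
  The twistor equation says that the derivative equals \<open>F\<^sup>+ (\<i> / l) F\<^sup>-\<close> of itself, and the Dirac
  equation then identifies the argument of \<open>F\<^sup>+\<close> as a multiple of \<open>\<phi>\<close>, with Dirac eigenvalue
  \<open>\<mu> = \<i> l \<lambda>\<close>.\<close>


section \<open>Calculus of smooth functions\<close>

lemma dir_derivs_append: "dir_derivs (vs @ ws) f = dir_derivs vs (dir_derivs ws f)"
  by (induction vs) auto

lemma frechet_derivative_cong_open:
  assumes "open S" and "x \<in> S" and "\<And>y. y \<in> S \<Longrightarrow> f y = g y"
  shows "frechet_derivative f (at x) = frechet_derivative g (at x)"
proof -
  have "(f has_derivative D) (at x) \<longleftrightarrow> (g has_derivative D) (at x)" for D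
    using assms by (metis has_derivative_transform_within_open)
  then show ?thesis
    by (simp add: frechet_derivative_def)
qed

lemma differentiable_cong_open:
  assumes "open S" and "x \<in> S" and "\<And>y. y \<in> S \<Longrightarrow> f y = g y" and "f differentiable at x"
  shows "g differentiable at x"
  using assms unfolding differentiable_def by (metis has_derivative_transform_within_open)

lemma dir_derivs_cong_open:
  assumes "open S" and "x \<in> S" and "\<And>y. y \<in> S \<Longrightarrow> f y = g y"
  shows "dir_derivs vs f x = dir_derivs vs g x"
  using assms(2)
proof (induction vs arbitrary: x)
  case (Cons v vs)
  then show ?case
    using frechet_derivative_cong_open[OF assms(1), of x "dir_derivs vs f" "dir_derivs vs g"] by simp
qed (simp add: assms(3))

lemma smooth_on_cong:
  assumes "smooth_on S f" and "open S" and "\<And>y. y \<in> S \<Longrightarrow> f y = g y"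
  shows "smooth_on S g"
  unfolding smooth_on_def
proof (intro allI ballI)
  fix vs x assume x: "x \<in> S"
  then have "dir_derivs vs f differentiable at x"
    using assms(1) by (simp add: smooth_on_def)
  then show "dir_derivs vs g differentiable at x"
    by (rule differentiable_cong_open[OF assms(2) x, rotated])
      (rule dir_derivs_cong_open[OF assms(2) _ assms(3)])
qed

lemma smooth_on_Un: "smooth_on (S \<union> T) f \<longleftrightarrow> smooth_on S f \<and> smooth_on T f"
  by (auto simp: smooth_on_def)

lemma smooth_on_subset: "smooth_on T f \<Longrightarrow> S \<subseteq> T \<Longrightarrow> smooth_on S f"
  by (auto simp: smooth_on_def)

lemma smooth_on_differentiable: "smooth_on S f \<Longrightarrow> x \<in> S \<Longrightarrow> f differentiable at x"
  using dir_derivs.simps(1) unfolding smooth_on_def by metis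

lemma smooth_on_derivative:
  assumes "smooth_on S f"
  shows "smooth_on S (\<lambda>x. frechet_derivative f (at x) v)"
  unfolding smooth_on_def
proof (intro allI ballI)
  fix vs x assume "x \<in> S"
  then have "dir_derivs (vs @ [v]) f differentiable at x"
    using assms unfolding smooth_on_def by blast
  then show "dir_derivs vs (\<lambda>x. frechet_derivative f (at x) v) differentiable at x"
    by (simp add: dir_derivs_append)
qed

text \<open>A family closed under directional derivatives, up to equality on the open set
  \<open>S\<close>, contains every iterated derivative of its members up to equality on
  \<open>S\<close>. This avoids computing higher derivatives of the flat functions below.\<close>

lemma smooth_on_coinduct:
  assumes "f \<in> F" and "open S"
    and diff: "\<And>f x. f \<in> F \<Longrightarrow> x \<in> S \<Longrightarrow> f differentiable at x"
    and step: "\<And>f v. f \<in> F \<Longrightarrow> \<exists>g\<in>F. \<forall>x\<in>S. frechet_derivative f (at x) v = g x"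
  shows "smooth_on S f"
proof -
  have "\<exists>g\<in>F. \<forall>x\<in>S. dir_derivs vs f x = g x" for vs
  proof (induction vs)
    case (Cons v vs)
    then obtain g where g: "g \<in> F" "\<forall>x\<in>S. dir_derivs vs f x = g x" by blast
    then have "\<forall>x\<in>S. dir_derivs (v # vs) f x = frechet_derivative g (at x) v"
      using frechet_derivative_cong_open[OF \<open>open S\<close>, of _ "dir_derivs vs f" g] by auto
    then show ?case using step[OF g(1), of v] by metis
  qed (use \<open>f \<in> F\<close> in auto)
  then show ?thesis
    unfolding smooth_on_def using diff differentiable_cong_open[OF \<open>open S\<close>] by metis
qed

section \<open>Closure of smoothness under sums, products and composition\<close>

text \<open>The recursion differentiates \<open>f\<close> first, whereas \<open>dir_derivs\<close>
  adds the last derivative on the outside. With a counter and the derivative inside, the Leibniz and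
  chain rules can be iterated by induction on \<open>n\<close> for all functions at once.\<close>

primrec times_differentiable_on ::
  "nat \<Rightarrow> 'a::real_normed_vector set \<Rightarrow> ('a \<Rightarrow> 'b::real_normed_vector) \<Rightarrow> bool" where
  "times_differentiable_on 0 S f \<longleftrightarrow> (\<forall>x\<in>S. f differentiable at x)"
| "times_differentiable_on (Suc n) S f \<longleftrightarrow> (\<forall>x\<in>S. f differentiable at x) \<and>
     (\<forall>v. times_differentiable_on n S (\<lambda>x. frechet_derivative f (at x) v))"

lemma times_differentiable_on_iff_dir_derivs:
  "times_differentiable_on n S f \<longleftrightarrow>
     (\<forall>vs. length vs \<le> n \<longrightarrow> (\<forall>x\<in>S. dir_derivs vs f differentiable at x))"
proof (induction n arbitrary: f)
  case (Suc n)
  have "(\<forall>vs. length vs \<le> Suc n \<longrightarrow> P vs) \<longleftrightarrow> P [] \<and> (\<forall>v vs. length vs \<le> n \<longrightarrow> P (vs @ [v]))"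
    for P :: "'a list \<Rightarrow> bool"
  proof (intro iffI conjI allI impI)
    fix vs :: "'a list"
    assume "P [] \<and> (\<forall>v vs. length vs \<le> n \<longrightarrow> P (vs @ [v]))" "length vs \<le> Suc n"
    \<comment> \<open>The last entry of the list is the direction of the derivative taken first,
      which is why the list is split at its end.\<close>
    then show "P vs" by (cases vs rule: rev_cases) auto
  qed auto
  then show ?case by (simp add: Suc dir_derivs_append)
qed simp

lemma smooth_on_iff_times_differentiable_on:
  "smooth_on S f \<longleftrightarrow> (\<forall>n. times_differentiable_on n S f)"
  unfolding smooth_on_def times_differentiable_on_iff_dir_derivs by blast

lemma times_differentiable_on_cong:
  fixes f :: "'a::real_normed_vector \<Rightarrow> 'b::real_normed_vector"
  assumes "times_differentiable_on n S f" and "open S" and "\<And>y. y \<in> S \<Longrightarrow> f y = g y"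
  shows "times_differentiable_on n S g"
  unfolding times_differentiable_on_iff_dir_derivs
proof (intro allI ballI impI)
  fix vs :: "'a list" and x assume vs: "length vs \<le> n" and x: "x \<in> S"
  then have "dir_derivs vs f differentiable at x"
    using assms(1) unfolding times_differentiable_on_iff_dir_derivs by blast
  then show "dir_derivs vs g differentiable at x"
    by (rule differentiable_cong_open[OF assms(2) x, rotated])
      (rule dir_derivs_cong_open[OF assms(2) _ assms(3)])
qed

lemma times_differentiable_on_Suc: "times_differentiable_on (Suc n) S f \<Longrightarrow> times_differentiable_on n S f"
  unfolding times_differentiable_on_iff_dir_derivs by simp

lemma frechet_derivative_eq: "(f has_derivative D) (at x) \<Longrightarrow> frechet_derivative f (at x) v = D v"
  using frechet_derivative_at by metis

lemma has_derivative_frechet: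
  "f differentiable at x \<Longrightarrow> (f has_derivative (\<lambda>v. frechet_derivative f (at x) v)) (at x)"
  using frechet_derivative_works by metis

lemma times_differentiable_on_const: "times_differentiable_on n S (\<lambda>x. c)"
  by (induction n arbitrary: c) auto

text \<open>The derivative of a bounded linear map does not depend on the point, so after one step
  only constants remain.\<close>

lemma times_differentiable_on_linear:
  assumes "bounded_linear h"
  shows "times_differentiable_on n S h"
proof -
  have h: "(h has_derivative h) (at x)" for x
    using assms by (rule bounded_linear_imp_has_derivative)
  then have "frechet_derivative h (at x) v = h v" for x v
    by (rule frechet_derivative_eq)
  with h show ?thesis
    by (cases n) (auto simp: times_differentiable_on_const differentiable_def)
qed

lemma times_differentiable_on_add:
  assumes "open S"
  shows "times_differentiable_on n S f \<Longrightarrow> times_differentiable_on n S g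
    \<Longrightarrow> times_differentiable_on n S (\<lambda>x. f x + g x)"
proof (induction n arbitrary: f g)
  case (Suc n)
  show ?case unfolding times_differentiable_on.simps
  proof (intro conjI allI)
    fix v
    have "times_differentiable_on n S
        (\<lambda>x. frechet_derivative f (at x) v + frechet_derivative g (at x) v)"
      using Suc by simp
    then show "times_differentiable_on n S (\<lambda>x. frechet_derivative (\<lambda>x. f x + g x) (at x) v)"
    proof (rule times_differentiable_on_cong[OF _ assms])
      fix x assume "x \<in> S"
      then have "f differentiable at x" "g differentiable at x" using Suc.prems by auto
      from has_derivative_add[OF this[THEN has_derivative_frechet]]
      show "frechet_derivative f (at x) v + frechet_derivative g (at x) v
        = frechet_derivative (\<lambda>x. f x + g x) (at x) v"
        by (simp add: frechet_derivative_eq)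
    qed
  qed (use Suc.prems in auto)
qed auto

lemma times_differentiable_on_sum:
  assumes "open S" and "\<And>i. i \<in> I \<Longrightarrow> times_differentiable_on n S (f i)"
  shows "times_differentiable_on n S (\<lambda>x. \<Sum>i\<in>I. f i x)"
  using assms(2)
  by (induction I rule: infinite_finite_induct)
    (auto simp: times_differentiable_on_const intro: times_differentiable_on_add[OF assms(1)])

lemma (in bounded_bilinear) differentiable_prod:
  "f differentiable at x \<Longrightarrow> g differentiable at x \<Longrightarrow> (\<lambda>x. prod (f x) (g x)) differentiable at x"
  unfolding differentiable_def using FDERIV by blast

text \<open>By the Leibniz rule the derivative is a sum of two terms of the same shape. In each, one
  factor is differentiated and the other one merely loses an order, so the induction hypothesis for
  arbitrary \<open>f\<close> and \<open>g\<close> applies.\<close>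

lemma times_differentiable_on_bilinear:
  assumes "bounded_bilinear B" and "open S"
  shows "times_differentiable_on n S f \<Longrightarrow> times_differentiable_on n S g
    \<Longrightarrow> times_differentiable_on n S (\<lambda>x. B (f x) (g x))"
proof (induction n arbitrary: f g)
  case 0
  then show ?case by (auto intro: bounded_bilinear.differentiable_prod[OF assms(1)])
next
  case (Suc n)
  show ?case unfolding times_differentiable_on.simps
  proof (intro conjI allI ballI)
    fix v
    have "times_differentiable_on n S
        (\<lambda>x. B (f x) (frechet_derivative g (at x) v) + B (frechet_derivative f (at x) v) (g x))"
      using Suc.IH Suc.prems Suc.prems[THEN times_differentiable_on_Suc]
      by (intro times_differentiable_on_add[OF assms(2)]) auto
    then show "times_differentiable_on n S (\<lambda>x. frechet_derivative (\<lambda>x. B (f x) (g x)) (at x) v)"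
    proof (rule times_differentiable_on_cong[OF _ assms(2)])
      fix x assume "x \<in> S"
      then have "f differentiable at x" "g differentiable at x" using Suc.prems by auto
      from bounded_bilinear.FDERIV[OF assms(1) this[THEN has_derivative_frechet]]
      show "B (f x) (frechet_derivative g (at x) v) + B (frechet_derivative f (at x) v) (g x)
        = frechet_derivative (\<lambda>x. B (f x) (g x)) (at x) v"
        by (simp add: frechet_derivative_eq)
    qed
  next
    fix x assume "x \<in> S"
    then show "(\<lambda>x. B (f x) (g x)) differentiable at x"
      using Suc.prems by (auto intro: bounded_bilinear.differentiable_prod[OF assms(1)])
  qed
qed

lemma times_differentiable_on_compose:
  fixes f :: "'a::real_normed_vector \<Rightarrow> 'b::euclidean_space"
  assumes "open S" and "open T" and "f ` S \<subseteq> T"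
  shows "times_differentiable_on n S f \<Longrightarrow> times_differentiable_on n T g
    \<Longrightarrow> times_differentiable_on n S (g \<circ> f)"
proof (induction n arbitrary: g)
  case 0
  then show ?case
    using assms(3) differentiable_chain_at unfolding times_differentiable_on.simps by blast
next
  case (Suc n)
  have f: "times_differentiable_on n S f" and g: "times_differentiable_on n T g"
    using Suc.prems by (auto dest: times_differentiable_on_Suc simp del: times_differentiable_on.simps)
  show ?case unfolding times_differentiable_on.simps
  proof (intro conjI allI ballI)
    fix v
    \<comment> \<open>The direction in which \<open>g\<close> is differentiated varies with
      \<open>x\<close>. Expanding it in the basis of the Euclidean middle space leaves derivatives
      of \<open>g\<close> in fixed directions composed with \<open>f\<close>, to which the induction
      hypothesis applies.\<close>
    have "times_differentiable_on n S (\<lambda>x. \<Sum>b\<in>Basis.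
        (frechet_derivative f (at x) v \<bullet> b) *\<^sub>R ((\<lambda>y. frechet_derivative g (at y) b) \<circ> f) x)"
    proof (intro times_differentiable_on_sum[OF assms(1)]
        times_differentiable_on_bilinear[OF bounded_bilinear_scaleR assms(1)]
        times_differentiable_on_bilinear[OF bounded_bilinear_inner assms(1)]
        times_differentiable_on_const)
      show "times_differentiable_on n S (\<lambda>x. frechet_derivative f (at x) v)"
        using Suc.prems by simp
      fix b :: 'b
      have "times_differentiable_on n T (\<lambda>y. frechet_derivative g (at y) b)"
        using Suc.prems by simp
      from Suc.IH[OF f this]
      show "times_differentiable_on n S (((\<lambda>y. frechet_derivative g (at y) b) \<circ> f))" .
    qed
    then show "times_differentiable_on n S (\<lambda>x. frechet_derivative (g \<circ> f) (at x) v)"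
    proof (rule times_differentiable_on_cong[OF _ assms(1)])
      fix x assume x: "x \<in> S"
      have df: "f differentiable at x" using x Suc.prems by auto
      have dg: "g differentiable at (f x)" using x Suc.prems assms(3) by auto
      have lin: "linear (frechet_derivative g (at (f x)))"
        using dg by (rule linear_frechet_derivative)
      have "frechet_derivative (g \<circ> f) (at x) v
          = frechet_derivative g (at (f x)) (frechet_derivative f (at x) v)"
        using frechet_derivative_compose[OF df dg] by simp
      also have "\<dots> = frechet_derivative g (at (f x))
          (\<Sum>b\<in>Basis. (frechet_derivative f (at x) v \<bullet> b) *\<^sub>R b)"
        by (simp add: euclidean_representation)
      also have "\<dots> = (\<Sum>b\<in>Basis. (frechet_derivative f (at x) v \<bullet> b) *\<^sub>R frechet_derivative g (at (f x)) b)"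
        by (simp add: linear_sum[OF lin] linear_cmul[OF lin])
      finally show "(\<Sum>b\<in>Basis.
        (frechet_derivative f (at x) v \<bullet> b) *\<^sub>R ((\<lambda>y. frechet_derivative g (at y) b) \<circ> f) x)
        = frechet_derivative (g \<circ> f) (at x) v" by simp
    qed
  next
    fix x assume "x \<in> S"
    then show "(g \<circ> f) differentiable at x"
      using Suc.prems assms(3) differentiable_chain_at[of f x g] by auto
  qed
qed

lemma smooth_on_const: "smooth_on S (\<lambda>x. c)"
  by (simp add: smooth_on_iff_times_differentiable_on times_differentiable_on_const)

lemma smooth_on_linear: "bounded_linear h \<Longrightarrow> smooth_on S h"
  by (simp add: smooth_on_iff_times_differentiable_on times_differentiable_on_linear)

lemma smooth_on_add:
  "open S \<Longrightarrow> smooth_on S f \<Longrightarrow> smooth_on S g \<Longrightarrow> smooth_on S (\<lambda>x. f x + g x)"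
  by (simp add: smooth_on_iff_times_differentiable_on times_differentiable_on_add)

lemma smooth_on_bilinear:
  "bounded_bilinear B \<Longrightarrow> open S \<Longrightarrow> smooth_on S f \<Longrightarrow> smooth_on S g \<Longrightarrow> smooth_on S (\<lambda>x. B (f x) (g x))"
  by (simp add: smooth_on_iff_times_differentiable_on times_differentiable_on_bilinear)

lemma smooth_on_compose:
  "open S \<Longrightarrow> open T \<Longrightarrow> f ` S \<subseteq> T \<Longrightarrow> smooth_on S f \<Longrightarrow> smooth_on T g \<Longrightarrow> smooth_on S (g \<circ> f)"
  by (simp add: smooth_on_iff_times_differentiable_on times_differentiable_on_compose)


section \<open>Bump functions and vector fields\<close>

text \<open>The flat function exp(-1/t), extended by zero. The polynomial in 1/t is carried along
  because differentiation produces such factors.\<close>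

definition exp_flat :: "real poly \<Rightarrow> real \<Rightarrow> real" where
  "exp_flat p t = (if t > 0 then poly p (1 / t) * exp (- (1 / t)) else 0)"

lemma tendsto_poly_times_exp: "((\<lambda>s. poly p s * exp (- s)) \<longlongrightarrow> (0::real)) at_top"
proof -
  have "((\<lambda>s. \<Sum>i\<le>degree p. coeff p i * (s ^ i / exp s)) \<longlongrightarrow> (\<Sum>i\<le>degree p. coeff p i * 0)) at_top"
    by (intro tendsto_intros tendsto_power_div_exp_0)
  then show ?thesis
    by (simp add: poly_altdef exp_minus divide_inverse sum_distrib_right mult.assoc)
qed

lemma exp_flat_tendsto_0: "(exp_flat p \<longlongrightarrow> 0) (at 0)"
proof -
  have "((\<lambda>t. poly p (1 / t) * exp (- (1 / t))) \<longlongrightarrow> 0) (at_right 0)"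
    using filterlim_compose[OF tendsto_poly_times_exp filterlim_inverse_at_top_right]
    by (simp add: divide_inverse)
  then have "(exp_flat p \<longlongrightarrow> 0) (at_right 0)"
    by (rule Lim_transform_eventually) (auto simp: exp_flat_def eventually_at_right_less eventually_at_filter)
  moreover have "(exp_flat p \<longlongrightarrow> 0) (at_left 0)"
    by (rule tendsto_eventually) (auto simp: exp_flat_def eventually_at_filter)
  ultimately show ?thesis
    by (simp add: filterlim_at_split)
qed

text \<open>With s = 1/t one has ds/dt = -s^2, so the derivative of p(s) exp(-s) is s^2 (p(s) -
  p'(s)) exp(-s).\<close>

definition exp_flat_deriv :: "real poly \<Rightarrow> real poly" where
  "exp_flat_deriv p = [:0, 0, 1:] * (p - pderiv p)"

lemma exp_flat_has_derivative:
  "(exp_flat p has_field_derivative exp_flat (exp_flat_deriv p) t) (at t)"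
proof -
  consider "t > 0" | "t < 0" | "t = 0" by linarith
  then show ?thesis
  proof cases
    case 1
    have "((\<lambda>t. poly p (1 / t) * exp (- (1 / t))) has_field_derivative
        exp_flat (exp_flat_deriv p) t) (at t)"
      using 1 by (auto intro!: derivative_eq_intros DERIV_chain'[where g = "poly p"] poly_DERIV
          simp: exp_flat_def exp_flat_deriv_def power2_eq_square field_simps)
    then show ?thesis
      by (rule has_field_derivative_transform_within_open[where S = "{0<..}"])
        (use 1 in \<open>auto simp: exp_flat_def\<close>)
  next
    case 2
    have "((\<lambda>t. 0) has_field_derivative exp_flat (exp_flat_deriv p) t) (at t)"
      using 2 by (simp add: exp_flat_def)
    then show ?thesis
      by (rule has_field_derivative_transform_within_open[where S = "{..<0}"])
        (use 2 in \<open>auto simp: exp_flat_def\<close>)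
  next
    case 3
    \<comment> \<open>Dividing by \<open>h\<close> multiplies the polynomial by its variable 1/h, so
      the difference quotient is again a flat function and tends to 0.\<close>
    have "((\<lambda>h. (exp_flat p (0 + h) - exp_flat p 0) / h) \<longlongrightarrow> 0) (at 0)"
      using exp_flat_tendsto_0[of "[:0, 1:] * p"]
      by (rule Lim_transform_eventually) (auto simp: exp_flat_def eventually_at_filter)
    then show ?thesis
      using 3 by (simp add: DERIV_def exp_flat_def)
  qed
qed

lemma smooth_on_exp_flat: "smooth_on UNIV (exp_flat p)"
proof (rule smooth_on_coinduct)
  \<comment> \<open>The constant factor is part of the family because the derivative in direction
    \<open>v\<close> is \<open>v\<close> times the ordinary derivative.\<close>
  show "exp_flat p \<in> {\<lambda>t. c * exp_flat p t | c p. True}"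
    by (auto intro!: exI[of _ "1::real"] exI[of _ p])
next
  fix f and x :: real
  assume "f \<in> {\<lambda>t. c * exp_flat p t | c p. True}"
  then obtain c p where f: "f = (\<lambda>t. c * exp_flat p t)" by auto
  have *: "(f has_derivative (\<lambda>h. c * (h * exp_flat (exp_flat_deriv p) x))) (at x)" for x
    unfolding f using exp_flat_has_derivative[of p x]
    by (auto simp: has_field_derivative_def mult.commute[of _ "exp_flat _ _"] intro!: derivative_eq_intros)
  show "f differentiable at x" using * by (auto simp: differentiable_def)
  fix v
  show "\<exists>g\<in>{\<lambda>t. c * exp_flat p t | c p. True}. \<forall>x\<in>UNIV. frechet_derivative f (at x) v = g x"
    using frechet_derivative_eq[OF *]
    by (auto intro!: exI[of _ "c * v"] exI[of _ "exp_flat_deriv p"])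
qed simp

lemma smooth_bump_function:
  fixes a :: "'a::euclidean_space"
  assumes "r > 0"
  obtains b :: "'a \<Rightarrow> real" where "smooth_on UNIV b" "b a = 1" "\<And>x. r \<le> dist a x \<Longrightarrow> b x = 0"
proof
  define u where "u x = r\<^sup>2 + (- ((x - a) \<bullet> (x - a)))" for x :: 'a
  \<comment> \<open>The argument of the flat function is positive exactly on the open ball of radius
    \<open>r\<close>; the prefactor normalizes the value at the centre to 1.\<close>
  define b where "b x = exp (1 / r\<^sup>2) * (exp_flat 1 \<circ> u) x" for x
  have lin: "smooth_on UNIV (\<lambda>x. x - a)"
    using smooth_on_add[OF open_UNIV smooth_on_linear[OF bounded_linear_ident] smooth_on_const[of _ "- a"]]
    by simp
  have "smooth_on UNIV u"
    unfolding u_def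
    using smooth_on_add[OF open_UNIV smooth_on_const[of _ "r\<^sup>2"]
        smooth_on_bilinear[OF bounded_bilinear_mult open_UNIV smooth_on_const[of _ "-1"]
        smooth_on_bilinear[OF bounded_bilinear_inner open_UNIV lin lin]]]
    by simp
  then show "smooth_on UNIV b"
    unfolding b_def
    by (intro smooth_on_bilinear[OF bounded_bilinear_mult] smooth_on_const
        smooth_on_compose[OF _ open_UNIV _ _ smooth_on_exp_flat]) auto
  show "b a = 1"
    using assms by (simp add: b_def u_def exp_flat_def flip: exp_add)
  show "b x = 0" if "r \<le> dist a x" for x
  proof -
    have "r \<le> norm (x - a)"
      using that by (simp add: dist_norm norm_minus_commute)
    then have "r\<^sup>2 \<le> (x - a) \<bullet> (x - a)"
      using power_mono[of r "norm (x - a)" 2] assms by (simp add: power2_norm_eq_inner)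
    then show ?thesis
      by (simp add: b_def u_def exp_flat_def)
  qed
qed

section \<open>Charts, transition maps and vector fields with a prescribed value\<close>

text \<open>\<open>chart_inv\<close> only chooses preimages, but the coordinate map is injective on
  the chart domain, so the choice agrees there with the continuous inverse of the
  homeomorphism.\<close>

lemma
  assumes "smooth_manifold A" and "c \<in> A"
  shows open_chart_domain: "open (fst c)"
    and chart_inv_left: "\<And>y. y \<in> fst c \<Longrightarrow> chart_inv c (snd c y) = y"
    and chart_inv_right: "\<And>z. z \<in> snd c ` fst c \<Longrightarrow> snd c (chart_inv c z) = z"
    and chart_inv_in: "\<And>z. z \<in> snd c ` fst c \<Longrightarrow> chart_inv c z \<in> fst c"
    and continuous_on_chart_inv: "continuous_on (snd c ` fst c) (chart_inv c)"
    and open_chart_image: "\<And>W. open W \<Longrightarrow> open (snd c ` (fst c \<inter> W))"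
proof -
  obtain g where op: "open (fst c)" "open (snd c ` fst c)"
    and g: "homeomorphism (fst c) (snd c ` fst c) (snd c) g"
    using assms unfolding smooth_manifold_def by blast
  have inj: "inj_on (snd c) (fst c)"
    using g unfolding homeomorphism_def by (metis inj_onI)
  show "open (fst c)" by fact
  show left: "chart_inv c (snd c y) = y" if "y \<in> fst c" for y
    using inj that by (simp add: chart_inv_def)
  show "snd c (chart_inv c z) = z" and "chart_inv c z \<in> fst c" if "z \<in> snd c ` fst c" for z
    using that by (auto simp: chart_inv_def f_inv_into_f inv_into_into)
  show cont: "continuous_on (snd c ` fst c) (chart_inv c)"
    using g left unfolding homeomorphism_def by (auto intro: continuous_on_eq)
  show "open (snd c ` (fst c \<inter> W))" if "open W" for W
  proof -
    have "snd c ` (fst c \<inter> W) = chart_inv c -` W \<inter> snd c ` fst c"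
      using left by auto
    then show ?thesis
      using cont op(2) that by (simp add: continuous_on_open_vimage)
  qed
qed

lemma transition_smooth_on:
  assumes "smooth_manifold A" and "c \<in> A" and "d \<in> A"
  shows "smooth_on (snd c ` (fst c \<inter> fst d)) (snd d \<circ> chart_inv c)"
  using assms by (simp add: smooth_manifold_def)

lemma transition_differentiable:
  assumes "smooth_manifold A" and "c \<in> A" and "d \<in> A" and "y \<in> fst c" and "y \<in> fst d"
  shows "(snd d \<circ> chart_inv c) differentiable at (snd c y)"
  using smooth_on_differentiable[OF transition_smooth_on[OF assms(1-3)]] assms(4,5) by blast

lemma chart_at:
  assumes "smooth_manifold A"
  shows "chart_at A x \<in> A" and "x \<in> fst (chart_at A x)"
proof -
  have "\<exists>c. c \<in> A \<and> x \<in> fst c"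
    using assms unfolding smooth_manifold_def by blast
  then have "chart_at A x \<in> A \<and> x \<in> fst (chart_at A x)"
    unfolding chart_at_def by (rule someI_ex)
  then show "chart_at A x \<in> A" and "x \<in> fst (chart_at A x)" by auto
qed

text \<open>This is the chain rule. The transition map from \<open>c\<close> to \<open>e\<close>
  factors through \<open>d\<close> on the overlap of \<open>c\<close> and \<open>d\<close> only, and
  openness of its image makes this enough for derivatives.\<close>

lemma transition_derivative_compose:
  assumes "smooth_manifold A" and "c \<in> A" and "d \<in> A" and "e \<in> A"
    and "y \<in> fst c" and "y \<in> fst d" and "y \<in> fst e"
  shows "frechet_derivative (snd e \<circ> chart_inv d) (at (snd d y))
      (frechet_derivative (snd d \<circ> chart_inv c) (at (snd c y)) v)
    = frechet_derivative (snd e \<circ> chart_inv c) (at (snd c y)) v"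
proof -
  note inv = chart_inv_left[OF assms(1,2)] chart_inv_left[OF assms(1,3)]
  have eq: "(snd d \<circ> chart_inv c) (snd c y) = snd d y"
    using assms inv by simp
  have "frechet_derivative (snd e \<circ> chart_inv c) (at (snd c y))
      = frechet_derivative ((snd e \<circ> chart_inv d) \<circ> (snd d \<circ> chart_inv c)) (at (snd c y))"
  proof (rule frechet_derivative_cong_open)
    show "open (snd c ` (fst c \<inter> fst d))"
      using assms by (intro open_chart_image[OF assms(1)] open_chart_domain[OF assms(1)])
    show "(snd e \<circ> chart_inv c) z = ((snd e \<circ> chart_inv d) \<circ> (snd d \<circ> chart_inv c)) z"
      if "z \<in> snd c ` (fst c \<inter> fst d)" for z
      using that inv assms by auto
  qed (use assms in auto)
  also have "\<dots> = frechet_derivative (snd e \<circ> chart_inv d) (at (snd d y)) \<circ>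
      frechet_derivative (snd d \<circ> chart_inv c) (at (snd c y))"
    using frechet_derivative_compose[of "snd d \<circ> chart_inv c" "snd c y" "snd e \<circ> chart_inv d", unfolded eq]
      transition_differentiable[OF assms(1)] assms by simp
  finally show ?thesis by simp
qed

lemma differential_zero:
  assumes "smooth_manifold A" and "c \<in> A" and "y \<in> fst c"
  shows "differential A (snd c) y 0 = 0"
  unfolding differential_def
  using transition_differentiable[OF assms(1) chart_at(1)[OF assms(1)] assms(2) chart_at(2)[OF assms(1)] assms(3)]
    linear_frechet_derivative linear_0 by blast

text \<open>The field that is constant in the chart at \<open>x\<close> is cut off by a bump
  function and extended by zero.\<close>

lemma exists_vector_field:
  fixes A :: "('m::{t2_space, second_countable_topology}, 'e::euclidean_space) chart set"
  assumes A: "smooth_manifold A"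
  obtains X where "X \<in> vector_fields A" "X x = v"
proof -
  define c0 where "c0 = chart_at A x"
  have c0: "c0 \<in> A" "x \<in> fst c0"
    using chart_at[OF A] by (auto simp: c0_def)
  have op: "open (snd c0 ` fst c0)"
    using open_chart_image[OF A c0(1) open_UNIV] by simp
  then obtain r where r: "r > 0" "cball (snd c0 x) r \<subseteq> snd c0 ` fst c0"
    using c0(2) open_contains_cball by (metis imageI)
  obtain b :: "'e \<Rightarrow> real" where b: "smooth_on UNIV b" "b (snd c0 x) = 1"
    "\<And>z. r \<le> dist (snd c0 x) z \<Longrightarrow> b z = 0"
    using smooth_bump_function[OF r(1)] by blast
  \<comment> \<open>The cut-off field vanishes outside \<open>K\<close>. Since \<open>K\<close> is
    compact and the manifold is Hausdorff, \<open>K\<close> is closed, and the extension by zero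
    stays smooth across the boundary of the chart domain.\<close>
  define K where "K = chart_inv c0 ` cball (snd c0 x) r"
  have "compact K"
    unfolding K_def
    by (rule compact_continuous_image[OF continuous_on_subset[OF continuous_on_chart_inv[OF A c0(1)] r(2)]])
      simp
  then have K: "closed K" by (rule compact_imp_closed)
  have b_K: "b (snd c0 y) = 0" if "y \<in> fst c0" "y \<notin> K" for y
  proof (rule b(3))
    have "snd c0 y \<notin> cball (snd c0 x) r"
      using that chart_inv_left[OF A c0(1) that(1)] unfolding K_def by (metis imageI)
    then show "r \<le> dist (snd c0 x) (snd c0 y)" by simp
  qed
  \<comment> \<open>A tangent vector at \<open>y\<close> is recorded in the chart
    \<open>chart_at A y\<close>, so the vector given in the chart \<open>c0\<close> has to be
    transported by the derivative of the transition map.\<close>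
  define X where "X y = (if y \<in> fst c0 then frechet_derivative (snd (chart_at A y) \<circ> chart_inv c0)
      (at (snd c0 y)) (b (snd c0 y) *\<^sub>R v) else 0)" for y
  \<comment> \<open>Passing to the chart \<open>c\<close> cancels the choice of
    \<open>chart_at A y\<close>, which need not depend smoothly on \<open>y\<close>.\<close>
  have X: "differential A (snd c) y (X y)
      = b (snd c0 y) *\<^sub>R frechet_derivative (snd c \<circ> chart_inv c0) (at (snd c0 y)) v"
    if "c \<in> A" "y \<in> fst c" "y \<in> fst c0" for c y
    using that transition_derivative_compose[OF A c0(1) chart_at(1)[OF A, of y] that(1) that(3)
        chart_at(2)[OF A] that(2)]
      linear_cmul[OF linear_frechet_derivative[OF transition_differentiable[OF A c0(1) that(1,3,2)]]]
    by (simp add: differential_def X_def)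
  show thesis
  proof
    have "frechet_derivative (snd c0 \<circ> chart_inv c0) (at (snd c0 x)) = frechet_derivative id (at (snd c0 x))"
      by (rule frechet_derivative_cong_open[OF op])
        (use c0 chart_inv_right[OF A c0(1)] in auto)
    moreover have "frechet_derivative id (at (snd c0 x)) v = v"
      using frechet_derivative_eq[OF has_derivative_id] by (simp add: id_def)
    ultimately show "X x = v"
      using c0 b(2) by (simp add: X_def flip: c0_def)
    show "X \<in> vector_fields A"
      unfolding vector_fields_def smooth_fun_def
    proof (intro CollectI ballI)
      fix c d assume c: "c \<in> A" and d: "d \<in> A"
      define F where "F = (\<lambda>y. differential A (snd c) y (X y)) \<circ> chart_inv d"
      define W where "W = fst c \<inter> fst c0"
      have "open W" unfolding W_def
        using c c0 by (intro open_Int open_chart_domain[OF A])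
      define S where "S = snd d ` (fst d \<inter> W)"
      have S: "open S" unfolding S_def
        using open_chart_image[OF A d \<open>open W\<close>] .
      define T where "T = snd c0 ` (fst c0 \<inter> fst c)"
      have T: "open T" unfolding T_def
        using open_chart_image[OF A c0(1) open_chart_domain[OF A c]] .
      have tau: "smooth_on S (snd c0 \<circ> chart_inv d)"
        by (rule smooth_on_subset[OF transition_smooth_on[OF A d c0(1)]]) (auto simp: S_def W_def)
      have sub: "(snd c0 \<circ> chart_inv d) ` S \<subseteq> T"
        using chart_inv_left[OF A d] by (auto simp: S_def T_def W_def)
      \<comment> \<open>Where \<open>c0\<close> is available, the coordinates of \<open>X\<close>
        are a smooth function of the \<open>c0\<close>-coordinates, composed with the transition
        from \<open>d\<close> to \<open>c0\<close>.\<close>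
      have "smooth_on S ((\<lambda>z. b z *\<^sub>R frechet_derivative (snd c \<circ> chart_inv c0) (at z) v)
          \<circ> (snd c0 \<circ> chart_inv d))"
      proof (rule smooth_on_compose[OF S T sub tau])
        show "smooth_on T (\<lambda>z. b z *\<^sub>R frechet_derivative (snd c \<circ> chart_inv c0) (at z) v)"
          by (intro smooth_on_bilinear[OF bounded_bilinear_scaleR T] smooth_on_subset[OF b(1)]
              smooth_on_derivative) (auto simp: T_def transition_smooth_on[OF A c0(1) c])
      qed
      then have 1: "smooth_on S F"
        by (rule smooth_on_cong[OF _ S])
          (use X[OF c] chart_inv_left[OF A d] in \<open>auto simp: S_def W_def F_def\<close>)
      define S' where "S' = snd d ` (fst d \<inter> (fst c - K))"
      have S': "open S'" unfolding S'_def
        by (rule open_chart_image[OF A d open_Diff[OF open_chart_domain[OF A c] K]])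
      have zero: "differential A (snd c) y (X y) = 0" if "y \<in> fst c" "y \<notin> K" for y
      proof (cases "y \<in> fst c0")
        case True
        then show ?thesis using X[OF c that(1) True] b_K[OF True that(2)] by simp
      next
        case False
        then show ?thesis using differential_zero[OF A c that(1)] by (simp add: X_def)
      qed
      have 2: "smooth_on S' F"
        by (rule smooth_on_cong[OF smooth_on_const[of _ 0] S'])
          (use zero chart_inv_left[OF A d] in \<open>auto simp: S'_def F_def\<close>)
      \<comment> \<open>As \<open>K\<close> lies in the domain of \<open>c0\<close>, that domain and
        the complement of \<open>K\<close> cover the manifold. The two smoothness statements
        therefore cover the whole overlap of \<open>c\<close> and \<open>d\<close>.\<close>
      have "K \<subseteq> fst c0"
        using r(2) chart_inv_in[OF A c0(1)] by (auto simp: K_def)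
      then have "snd d ` (fst d \<inter> fst c) = S \<union> S'"
        by (auto simp: S_def S'_def W_def)
      then show "smooth_on (snd d ` (fst d \<inter> fst c)) ((\<lambda>y. differential A (snd c) y (X y)) \<circ> chart_inv d)"
        using 1 2 by (simp add: smooth_on_Un flip: F_def)
    qed
  qed
qed


section \<open>Schwartz functions\<close>

lemma dir_derivs_add:
  assumes "smooth_on UNIV f" and "smooth_on UNIV g"
  shows "dir_derivs vs (\<lambda>x. f x + g x) x = dir_derivs vs f x + dir_derivs vs g x"
proof (induction vs arbitrary: x)
  case (Cons v vs)
  have "dir_derivs vs f differentiable at x" "dir_derivs vs g differentiable at x"
    using assms by (auto simp: smooth_on_def)
  from has_derivative_add[OF this[THEN has_derivative_frechet]] show ?case
    unfolding dir_derivs.simps Cons[abs_def] by (rule frechet_derivative_eq)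
qed simp

lemma dir_derivs_scale:
  fixes f :: "'a::euclidean_space \<Rightarrow> 'b::real_normed_algebra"
  assumes "smooth_on UNIV f"
  shows "dir_derivs vs (\<lambda>x. c * f x) x = c * dir_derivs vs f x"
proof (induction vs arbitrary: x)
  case (Cons v vs)
  have "dir_derivs vs f differentiable at x"
    using assms by (auto simp: smooth_on_def)
  from has_derivative_mult_right[OF this[THEN has_derivative_frechet], of c] show ?case
    unfolding dir_derivs.simps Cons[abs_def] by (rule frechet_derivative_eq)
qed simp

lemma smooth_on_mult:
  fixes f g :: "'a::euclidean_space \<Rightarrow> 'b::real_normed_algebra"
  shows "open S \<Longrightarrow> smooth_on S f \<Longrightarrow> smooth_on S g \<Longrightarrow> smooth_on S (\<lambda>x. f x * g x)"
  by (rule smooth_on_bilinear[OF bounded_bilinear_mult])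

lemma schwartz_add:
  assumes "schwartz f" and "schwartz g"
  shows "schwartz (\<lambda>x. f x + g x)"
proof -
  have s: "smooth_on UNIV f" "smooth_on UNIV g"
    using assms by (auto simp: schwartz_def)
  have "bounded (range (\<lambda>x. norm x ^ k *\<^sub>R dir_derivs vs (\<lambda>x. f x + g x) x))" for k vs
    unfolding dir_derivs_add[OF s] scaleR_add_right
    using assms by (intro bounded_plus_comp) (auto simp: schwartz_def)
  then show ?thesis
    unfolding schwartz_def using smooth_on_add[OF open_UNIV s] by blast
qed

lemma schwartz_scale:
  assumes "schwartz f"
  shows "schwartz (\<lambda>x. c * f x)"
proof -
  have s: "smooth_on UNIV f"
    using assms by (auto simp: schwartz_def)
  have "bounded (range (\<lambda>x. norm x ^ k *\<^sub>R dir_derivs vs (\<lambda>x. c * f x) x))" for k vs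
  proof -
    have "bounded (range (\<lambda>x. norm x ^ k *\<^sub>R dir_derivs vs f x))"
      using assms by (simp add: schwartz_def)
    from bounded_linear_image[OF this bounded_linear_mult_right[of c]] show ?thesis
      unfolding dir_derivs_scale[OF s] by (simp add: image_image mult.left_commute scaleR_conv_of_real)
  qed
  then show ?thesis
    unfolding schwartz_def using smooth_on_mult[OF open_UNIV smooth_on_const s] by blast
qed

lemma schwartz_derivative:
  assumes "schwartz f"
  shows "schwartz (\<lambda>x. frechet_derivative f (at x) v)"
  unfolding schwartz_def
proof (intro conjI allI)
  show "smooth_on UNIV (\<lambda>x. frechet_derivative f (at x) v)"
    using assms by (auto simp: schwartz_def intro: smooth_on_derivative)
  fix k vs
  have "bounded (range (\<lambda>x. norm x ^ k *\<^sub>R dir_derivs (vs @ [v]) f x))"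
    using assms unfolding schwartz_def by blast
  then show "bounded (range (\<lambda>x. norm x ^ k *\<^sub>R dir_derivs vs (\<lambda>x. frechet_derivative f (at x) v) x))"
    by (simp add: dir_derivs_append)
qed

lemma bounded_linear_complex_coord: "bounded_linear (\<lambda>x::real^'l::finite. complex_of_real (x $ i))"
  by (rule bounded_linear_compose[OF bounded_linear_of_real bounded_linear_vec_nth])

lemma frechet_derivative_coord_mult:
  fixes f :: "real^'l::finite \<Rightarrow> complex"
  assumes "f differentiable at x"
  shows "frechet_derivative (\<lambda>x. of_real (x $ i) * f x) (at x) v
    = of_real (x $ i) * frechet_derivative f (at x) v + of_real (v $ i) * f x"
  using frechet_derivative_eq[OF has_derivative_mult[OF
      bounded_linear_imp_has_derivative[OF bounded_linear_complex_coord] has_derivative_frechet[OF assms]]]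
  by simp

text \<open>Differentiating first in direction \<open>v\<close> turns the product into the
  coordinate times a derivative of \<open>f\<close>, which is again Schwartz, plus a constant
  multiple of \<open>f\<close>. The induction on the directions therefore runs over all Schwartz
  functions; in the base case the coordinate is absorbed into one more power of the norm.\<close>

lemma schwartz_coord_mult:
  assumes "schwartz f"
  shows "schwartz (\<lambda>x. of_real (x $ i) * f x)"
proof -
  have smooth: "smooth_on UNIV (\<lambda>x. of_real (x $ i) * f x)" if "schwartz f" for f
    using that by (intro smooth_on_mult smooth_on_linear[OF bounded_linear_complex_coord] open_UNIV)
      (simp add: schwartz_def)
  have "bounded (range (\<lambda>x. norm x ^ k *\<^sub>R dir_derivs vs (\<lambda>x. of_real (x $ i) * f x) x))" for k vs
    using assms
  proof (induction vs arbitrary: f rule: rev_induct)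
    case Nil
    have "bounded (range (\<lambda>x. norm x ^ Suc k *\<^sub>R dir_derivs [] f x))"
      using Nil unfolding schwartz_def by blast
    then obtain B where B: "\<And>x. norm (norm x ^ Suc k *\<^sub>R f x) \<le> B"
      unfolding bounded_iff by auto
    have "norm (norm x ^ k *\<^sub>R (of_real (x $ i) * f x)) \<le> B" for x
    proof -
      have "norm x ^ k * (\<bar>x $ i\<bar> * norm (f x)) \<le> norm x ^ k * (norm x * norm (f x))"
        by (intro mult_left_mono mult_right_mono component_le_norm_cart) auto
      also have "\<dots> \<le> B"
        using B[of x] by (simp add: mult_ac norm_mult norm_power)
      finally show ?thesis by (simp add: norm_mult norm_power)
    qed
    then show ?case by (auto simp: bounded_iff)
  next
    case (snoc v vs)
    define g where "g x = frechet_derivative f (at x) v" for x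
    have g: "schwartz g"
      unfolding g_def by (rule schwartz_derivative[OF snoc.prems])
    have f: "smooth_on UNIV f"
      using snoc.prems by (simp add: schwartz_def)
    have "dir_derivs (vs @ [v]) (\<lambda>x. of_real (x $ i) * f x)
        = dir_derivs vs (\<lambda>x. of_real (x $ i) * g x + of_real (v $ i) * f x)"
      using smooth_on_differentiable[OF f]
      by (simp add: dir_derivs_append frechet_derivative_coord_mult g_def)
    also have "\<dots> = (\<lambda>x. dir_derivs vs (\<lambda>x. of_real (x $ i) * g x) x + dir_derivs vs (\<lambda>x. of_real (v $ i) * f x) x)"
      by (rule ext) (intro dir_derivs_add smooth g smooth_on_mult smooth_on_const f open_UNIV)
    finally have eq: "dir_derivs (vs @ [v]) (\<lambda>x. of_real (x $ i) * f x) = \<dots>" .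
    show ?case unfolding eq scaleR_add_right
      using snoc.IH[OF g] schwartz_scale[OF snoc.prems, of "of_real (v $ i)"]
      by (intro bounded_plus_comp) (auto simp: schwartz_def)
  qed
  then show ?thesis
    unfolding schwartz_def using smooth[OF assms] by blast
qed

section \<open>Square integrability and uniqueness of Schwartz representatives\<close>

lemma integrable_lborel_inverse_1_plus_square: "integrable lborel (\<lambda>x::real. inverse (1 + x\<^sup>2))"
  using integrable_inverse_1_plus_square by (simp add: set_integrable_def)

text \<open>Lebesgue measure is the image of a product of one-dimensional Lebesgue measures indexed
  by \<open>Basis\<close>; the product over \<open>Basis\<close> is then reindexed by the
  coordinates.\<close>

lemma integrable_lborel_prod_coords:
  fixes g :: "real \<Rightarrow> real"
  assumes "integrable lborel g"
  shows "integrable lborel (\<lambda>x::real^'l::finite. \<Prod>i\<in>UNIV. g (x $ i))"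
proof -
  interpret product_sigma_finite "\<lambda>b::real^'l. lborel :: real measure" ..
  have [measurable]: "g \<in> borel_measurable borel"
    using borel_measurable_integrable[OF assms] by simp
  have "integrable (\<Pi>\<^sub>M b\<in>(Basis :: (real^'l) set). lborel) (\<lambda>x. \<Prod>b\<in>(Basis :: (real^'l) set). g (x b))"
    by (rule product_integrable_prod) (auto intro: assms)
  then have "integrable lborel (\<lambda>x::real^'l. \<Prod>b\<in>Basis. g (x \<bullet> b))"
    unfolding lborel_eq[where 'a = "real^'l"]
    by (subst integrable_distr_eq) (auto simp: inner_sum_left inner_Basis if_distrib cong: prod.cong if_cong)
  moreover have "(\<Prod>b\<in>Basis. g (x \<bullet> b)) = (\<Prod>i\<in>UNIV. g (x $ i))" for x :: "real^'l"
  proof -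
    have basis: "(Basis :: (real^'l) set) = (\<lambda>i. axis i 1) ` UNIV"
      by (auto simp: Basis_vec_def)
    have "inj (\<lambda>i::'l. axis i (1::real))"
      by (auto simp: inj_on_def axis_eq_axis)
    then show ?thesis
      unfolding basis by (subst prod.reindex) (simp_all add: inner_axis)
  qed
  ultimately show ?thesis by simp
qed

lemma schwartz_differentiable: "schwartz f \<Longrightarrow> f differentiable at x"
  using smooth_on_differentiable by (auto simp: schwartz_def)

lemma schwartz_continuous: "schwartz f \<Longrightarrow> continuous_on UNIV f"
  by (intro continuous_at_imp_continuous_on ballI differentiable_imp_continuous_within schwartz_differentiable)

text \<open>The square of the modulus is dominated by a multiple of the product of 1/(1 + x_i^2)
  over all coordinates, which is integrable.\<close>

lemma schwartz_square_integrable: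
  fixes f :: "real^'l::finite \<Rightarrow> complex"
  assumes "schwartz f"
  shows "square_integrable f"
proof -
  let ?l = "CARD('l)"
  have [measurable]: "f \<in> borel_measurable borel"
    using schwartz_continuous[OF assms] by (rule borel_measurable_continuous_onI)
  have "bounded (range (\<lambda>x. norm x ^ k *\<^sub>R dir_derivs [] f x))" for k
    using assms unfolding schwartz_def by blast
  then have "\<exists>B. \<forall>x. norm x ^ k * norm (f x) \<le> B" for k
    unfolding bounded_iff by (auto simp: norm_power norm_mult)
  then obtain B where B: "\<And>k x. norm x ^ k * norm (f x) \<le> B k" by metis
  \<comment> \<open>The exponent is the dimension, one factor for each coordinate in the dominating
    product. The cases norm at most 1 and norm above 1 give the two summands of the bound.\<close>
  have decay: "(1 + (norm x)\<^sup>2) ^ ?l * norm (f x) \<le> 2 ^ ?l * (B 0 + B (2 * ?l))" for x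
  proof -
    have "(1 + (norm x)\<^sup>2) ^ ?l \<le> 2 ^ ?l * (1 + norm x ^ (2 * ?l))"
    proof (cases "norm x \<le> 1")
      case True
      then have "(1 + (norm x)\<^sup>2) ^ ?l \<le> 2 ^ ?l"
        by (intro power_mono) (auto simp: power_le_one)
      also have "\<dots> \<le> 2 ^ ?l * (1 + norm x ^ (2 * ?l))" by simp
      finally show ?thesis .
    next
      case False
      then have "(1 + (norm x)\<^sup>2) ^ ?l \<le> (2 * (norm x)\<^sup>2) ^ ?l"
        by (intro power_mono) auto
      also have "\<dots> \<le> 2 ^ ?l * (1 + norm x ^ (2 * ?l))"
        by (simp add: power_mult_distrib power_mult)
      finally show ?thesis .
    qed
    then have "(1 + (norm x)\<^sup>2) ^ ?l * norm (f x) \<le> 2 ^ ?l * (1 + norm x ^ (2 * ?l)) * norm (f x)"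
      by (intro mult_right_mono) auto
    also have "\<dots> = 2 ^ ?l * (norm x ^ 0 * norm (f x) + norm x ^ (2 * ?l) * norm (f x))"
      by (simp add: algebra_simps)
    also have "\<dots> \<le> 2 ^ ?l * (B 0 + B (2 * ?l))"
      by (intro mult_left_mono add_mono B) auto
    finally show ?thesis .
  qed
  \<comment> \<open>One factor \<open>norm (f x)\<close> of the square is bounded by
    \<open>B 0\<close>, the other one by \<open>decay\<close>.\<close>
  define C where "C = B 0 * (2 ^ ?l * (B 0 + B (2 * ?l)))"
  have bound: "(norm (f x))\<^sup>2 \<le> C * (\<Prod>i\<in>UNIV. inverse (1 + (x $ i)\<^sup>2))" for x
  proof -
    have pos: "(\<Prod>i\<in>UNIV. 1 + (x $ i)\<^sup>2) > 0"
      by (intro prod_pos) (simp add: add_pos_nonneg)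
    have "(\<Prod>i\<in>UNIV. 1 + (x $ i)\<^sup>2) \<le> (\<Prod>i\<in>(UNIV :: 'l set). 1 + (norm x)\<^sup>2)"
      by (intro prod_mono) (use power_mono[OF component_le_norm_cart[of x] abs_ge_zero, of _ 2] in auto)
    then have "(norm (f x))\<^sup>2 * (\<Prod>i\<in>UNIV. 1 + (x $ i)\<^sup>2) \<le> (norm (f x))\<^sup>2 * (1 + (norm x)\<^sup>2) ^ ?l"
      by (intro mult_left_mono) auto
    also have "\<dots> = norm (f x) * ((1 + (norm x)\<^sup>2) ^ ?l * norm (f x))"
      by (simp add: power2_eq_square)
    also have "\<dots> \<le> C"
      unfolding C_def using B[of x 0] order_trans[OF _ B[of x 0]]
      by (intro mult_mono decay) auto
    finally have "(norm (f x))\<^sup>2 \<le> C / (\<Prod>i\<in>UNIV. 1 + (x $ i)\<^sup>2)"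
      using pos by (simp only: pos_le_divide_eq)
    then show ?thesis
      using prod_inversef[of "\<lambda>i. 1 + (x $ i)\<^sup>2" UNIV] by (simp add: o_def divide_inverse)
  qed
  have "integrable lborel (\<lambda>x. (norm (f x))\<^sup>2)"
  proof (rule Bochner_Integration.integrable_bound)
    show "integrable lborel (\<lambda>x::real^'l. C * (\<Prod>i\<in>UNIV. inverse (1 + (x $ i)\<^sup>2)))"
      using integrable_lborel_prod_coords[where 'l = 'l, OF integrable_lborel_inverse_1_plus_square] by simp
    show "AE x in lborel. norm ((norm (f x))\<^sup>2) \<le> norm (C * (\<Prod>i\<in>UNIV. inverse (1 + (x $ i)\<^sup>2)))"
      using bound by (intro AE_I2) (smt (verit) real_norm_def zero_le_power2)
  qed simp
  then show ?thesis
    by (simp add: square_integrable_def)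
qed

lemma L2_class_eq_iff:
  assumes "square_integrable f" and "square_integrable g"
  shows "L2_class f = L2_class g \<longleftrightarrow> (AE x in lborel. f x = g x)"
  using Quotient3_rel[OF Quotient3_L2, of f g] assms by auto

text \<open>The set where the functions differ is open and null, and a nonempty open set is not
  negligible.\<close>

lemma continuous_AE_eq:
  fixes f g :: "'a::euclidean_space \<Rightarrow> 'b::t2_space"
  assumes "AE x in lborel. f x = g x" and "continuous_on UNIV f" and "continuous_on UNIV g"
  shows "f = g"
proof -
  have op: "open {x. f x \<noteq> g x}"
    using assms(2,3) by (rule open_Collect_neq)
  have "{x. f x \<noteq> g x} \<in> null_sets lebesgue"
    using AE_completion[OF assms(1)] by (auto simp: AE_iff_null_sets op borel_open)
  then have "negligible {x. f x \<noteq> g x}"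
    by (simp add: negligible_iff_null_sets)
  then show ?thesis
    using open_not_negligible[OF op] by auto
qed

lemma schwartz_rep_L2_class:
  assumes "schwartz f"
  shows "schwartz_rep (L2_class f) = f"
  unfolding schwartz_rep_def
proof (rule the_equality)
  fix g assume "schwartz g \<and> L2_class g = L2_class f"
  then show "g = f"
    using assms by (auto intro!: continuous_AE_eq schwartz_continuous
        simp: L2_class_eq_iff schwartz_square_integrable)
qed (use assms in simp)


section \<open>Clifford multiplication and the operators on forms\<close>

lemma L2_class_add:
  "square_integrable f \<Longrightarrow> square_integrable g \<Longrightarrow> L2_class f + L2_class g = L2_class (\<lambda>x. f x + g x)"
  by (rule plus_L2.abs_eq) simp_all

lemma L2_class_scaleC:
  "square_integrable f \<Longrightarrow> c *\<^sub>C L2_class f = L2_class (\<lambda>x. c * f x)"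
  by (rule scaleC_L2.abs_eq) simp

lemma scaleC_add_right: "c *\<^sub>C (u + v) = c *\<^sub>C u + c *\<^sub>C v"
  by transfer (simp add: algebra_simps square_integrable_add square_integrable_scale)

lemma scaleC_scaleC: "a *\<^sub>C b *\<^sub>C u = (a * b) *\<^sub>C u"
  by transfer (simp add: algebra_simps square_integrable_scale)

lemma scaleR_eq_scaleC: "r *\<^sub>R u = of_real r *\<^sub>C u"
  by transfer (simp add: square_integrable_scale scaleR_conv_of_real)

lemma scaleC_one: "1 *\<^sub>C u = u"
  using scaleR_eq_scaleC[of 1 u] by simp

lemma scaleC_minus_one: "(-1) *\<^sub>C u = - u"
  using scaleR_eq_scaleC[of "-1" u] by simp

lemma scaleC_zero: "0 *\<^sub>C u = 0"
  using scaleR_eq_scaleC[of 0 u] by simp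

lemma linear_scaleC: "linear ((*\<^sub>C) c)"
  by (rule linearI) (simp_all add: scaleC_add_right scaleR_eq_scaleC scaleC_scaleC mult.commute)

text \<open>Clifford multiplication on functions instead of classes. Once
  \<open>schwartz_rep\<close> is eliminated, all computations can be done here pointwise.\<close>

primrec clifford_fun :: "'l::finite + 'l \<Rightarrow> (real^'l \<Rightarrow> complex) \<Rightarrow> real^'l \<Rightarrow> complex" where
  "clifford_fun (Inl i) f = (\<lambda>x. \<i> * of_real (x $ i) * f x)"
| "clifford_fun (Inr i) f = (\<lambda>x. frechet_derivative f (at x) (axis i 1))"

lemma clifford_basis_L2_class:
  "schwartz f \<Longrightarrow> clifford_basis k (L2_class f) = L2_class (clifford_fun k f)"
  by (cases k) (simp_all add: schwartz_rep_L2_class)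

lemma schwartz_clifford_fun: "schwartz f \<Longrightarrow> schwartz (clifford_fun k f)"
  using schwartz_scale[OF schwartz_coord_mult, of f \<i>]
  by (cases k) (simp_all add: schwartz_derivative mult.assoc)

lemma clifford_fun_linear:
  assumes "schwartz f" and "schwartz g"
  shows "clifford_fun k (\<lambda>x. a * f x + b * g x) = (\<lambda>x. a * clifford_fun k f x + b * clifford_fun k g x)"
proof (cases k)
  case (Inr i)
  have "((\<lambda>x. a * f x + b * g x) has_derivative
      (\<lambda>v. a * frechet_derivative f (at x) v + b * frechet_derivative g (at x) v)) (at x)" for x
    using assms[THEN schwartz_differentiable]
    by (intro has_derivative_add has_derivative_mult_right has_derivative_frechet)
  then have "frechet_derivative (\<lambda>x. a * f x + b * g x) (at x) v
      = a * frechet_derivative f (at x) v + b * frechet_derivative g (at x) v" for x v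
    by (rule frechet_derivative_eq)
  with Inr show ?thesis by simp
qed (simp add: fun_eq_iff algebra_simps)

text \<open>This is the canonical commutation relation, a consequence of the product rule.\<close>

lemma clifford_fun_commutator:
  assumes "schwartz f"
  shows "clifford_fun (Inr i) (clifford_fun (Inl i) f) x
    = clifford_fun (Inl i) (clifford_fun (Inr i) f) x + \<i> * f x"
proof -
  let ?g = "\<lambda>x. of_real (x $ i) * f x"
  \<comment> \<open>The zero summand brings the function into the form of a linear combination
    required by \<open>clifford_fun_linear\<close>.\<close>
  have "clifford_fun (Inr i) (clifford_fun (Inl i) f) x = clifford_fun (Inr i) (\<lambda>x. \<i> * ?g x + 0 * f x) x"
    by (simp add: mult.assoc)
  also have "\<dots> = \<i> * frechet_derivative ?g (at x) (axis i 1)"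
    by (subst clifford_fun_linear[OF schwartz_coord_mult[OF assms] assms]) simp
  also have "\<dots> = clifford_fun (Inl i) (clifford_fun (Inr i) f) x + \<i> * f x"
    by (simp add: frechet_derivative_coord_mult[OF schwartz_differentiable[OF assms]] distrib_left)
  finally show ?thesis .
qed

lemma schwartz_spaceE:
  assumes "u \<in> schwartz_space"
  obtains f where "schwartz f" "u = L2_class f"
  using assms by (auto simp: schwartz_space_def)

lemma schwartz_space_linear:
  assumes "u \<in> schwartz_space" and "v \<in> schwartz_space"
  shows "a *\<^sub>C u + b *\<^sub>C v \<in> schwartz_space"
proof -
  obtain f where f: "schwartz f" "u = L2_class f"
    using assms(1) by (rule schwartz_spaceE)
  obtain g where g: "schwartz g" "v = L2_class g"
    using assms(2) by (rule schwartz_spaceE)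
  note fg = f g
  have "a *\<^sub>C u + b *\<^sub>C v = L2_class (\<lambda>x. a * f x + b * g x)"
    using fg by (simp add: L2_class_scaleC L2_class_add schwartz_square_integrable schwartz_scale)
  moreover have "schwartz (\<lambda>x. a * f x + b * g x)"
    using fg by (intro schwartz_add schwartz_scale)
  ultimately show ?thesis
    unfolding schwartz_space_def by blast
qed

lemma
  assumes "u \<in> schwartz_space"
  shows schwartz_space_scaleC: "a *\<^sub>C u \<in> schwartz_space"
    and schwartz_space_uminus: "- u \<in> schwartz_space"
proof -
  show *: "a *\<^sub>C u \<in> schwartz_space" for a
    using schwartz_space_linear[OF assms assms, of a 0] by (simp add: scaleC_zero)
  show "- u \<in> schwartz_space" using *[of "-1"] by (simp add: scaleC_minus_one)
qed

lemma schwartz_space_add: "u \<in> schwartz_space \<Longrightarrow> v \<in> schwartz_space \<Longrightarrow> u + v \<in> schwartz_space"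
  using schwartz_space_linear[of u v 1 1] by (simp add: scaleC_one)

lemma schwartz_space_diff: "u \<in> schwartz_space \<Longrightarrow> v \<in> schwartz_space \<Longrightarrow> u - v \<in> schwartz_space"
  using schwartz_space_add[OF _ schwartz_space_uminus, of u v] by simp

lemma schwartz_space_0: "(0 :: 'l::finite L2) \<in> schwartz_space"
proof -
  have "dir_derivs vs (\<lambda>x::real^'l. 0::complex) = (\<lambda>x. 0)" for vs
    by (induction vs) auto
  then have "schwartz (\<lambda>x::real^'l. 0)"
    by (simp add: schwartz_def smooth_on_const image_constant_conv)
  then show ?thesis
    by (auto simp: schwartz_space_def zero_L2_def)
qed

lemma schwartz_space_sum:
  "(\<And>i. i \<in> I \<Longrightarrow> u i \<in> schwartz_space) \<Longrightarrow> (\<Sum>i\<in>I. u i) \<in> schwartz_space"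
  by (induction I rule: infinite_finite_induct) (auto simp: schwartz_space_0 schwartz_space_add)

lemma schwartz_space_clifford_basis:
  assumes "u \<in> schwartz_space"
  shows "clifford_basis k u \<in> schwartz_space"
proof -
  obtain f where f: "schwartz f" "u = L2_class f"
    using assms by (rule schwartz_spaceE)
  then have "clifford_basis k u = L2_class (clifford_fun k f)"
    by (simp add: clifford_basis_L2_class)
  with schwartz_clifford_fun[OF f(1), of k] show ?thesis
    unfolding schwartz_space_def by blast
qed

lemma clifford_basis_linear:
  assumes "u \<in> schwartz_space" and "v \<in> schwartz_space"
  shows "clifford_basis k (a *\<^sub>C u + b *\<^sub>C v) = a *\<^sub>C clifford_basis k u + b *\<^sub>C clifford_basis k v"
proof -
  obtain f where f: "schwartz f" "u = L2_class f"
    using assms(1) by (rule schwartz_spaceE)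
  obtain g where g: "schwartz g" "v = L2_class g"
    using assms(2) by (rule schwartz_spaceE)
  note fg = f g
  have "a *\<^sub>C u + b *\<^sub>C v = L2_class (\<lambda>x. a * f x + b * g x)"
    using fg by (simp add: L2_class_scaleC L2_class_add schwartz_square_integrable schwartz_scale)
  moreover have "schwartz (\<lambda>x. a * f x + b * g x)"
    using fg by (intro schwartz_add schwartz_scale)
  ultimately show ?thesis
    using fg by (simp add: clifford_basis_L2_class clifford_fun_linear L2_class_scaleC L2_class_add
        schwartz_square_integrable schwartz_scale schwartz_clifford_fun)
qed

lemma clifford_basis_scaleC:
  "u \<in> schwartz_space \<Longrightarrow> clifford_basis k (a *\<^sub>C u) = a *\<^sub>C clifford_basis k u"
  using clifford_basis_linear[of u u k a 0] by (simp add: scaleC_zero)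

lemma clifford_basis_diff:
  "u \<in> schwartz_space \<Longrightarrow> v \<in> schwartz_space
    \<Longrightarrow> clifford_basis k (u - v) = clifford_basis k u - clifford_basis k v"
  using clifford_basis_linear[of u v k 1 "-1"] by (simp add: scaleC_one scaleC_minus_one)

declare clifford_basis.simps [simp del]

lemma clifford_basis_commutator:
  assumes "u \<in> schwartz_space"
  shows "clifford_basis (Inr i) (clifford_basis (Inl i) u) - clifford_basis (Inl i) (clifford_basis (Inr i) u)
    = \<i> *\<^sub>C u"
proof -
  obtain f where f: "schwartz f" "u = L2_class f"
    using assms by (rule schwartz_spaceE)
  have "clifford_basis (Inr i) (clifford_basis (Inl i) u)
      = L2_class (clifford_fun (Inr i) (clifford_fun (Inl i) f))"
    using f(1) unfolding f(2) by (simp only: clifford_basis_L2_class schwartz_clifford_fun)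
  also have "\<dots> = L2_class (\<lambda>x. clifford_fun (Inl i) (clifford_fun (Inr i) f) x + \<i> * f x)"
    by (rule arg_cong[where f = L2_class], rule ext) (rule clifford_fun_commutator[OF f(1)])
  also have "\<dots> = L2_class (clifford_fun (Inl i) (clifford_fun (Inr i) f)) + L2_class (\<lambda>x. \<i> * f x)"
    using f by (intro L2_class_add[symmetric] schwartz_square_integrable schwartz_clifford_fun schwartz_scale)
  also have "\<dots> = clifford_basis (Inl i) (clifford_basis (Inr i) u) + \<i> *\<^sub>C u"
    using f(1) unfolding f(2)
    by (simp only: clifford_basis_L2_class schwartz_clifford_fun L2_class_scaleC schwartz_square_integrable)
  finally show ?thesis by simp
qed

lemma sum_axis_scaleR:
  fixes u :: "'n::finite \<Rightarrow> 'a::real_vector"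
  shows "(\<Sum>i\<in>UNIV. axis k 1 $ i *\<^sub>R u i) = u k"
proof -
  have "(\<Sum>i\<in>UNIV. axis k 1 $ i *\<^sub>R u i) = (\<Sum>i\<in>UNIV. if i = k then u i else 0)"
    by (rule sum.cong) (auto simp: axis_def)
  then show ?thesis by simp
qed

lemma clifford_axis: "clifford (axis k 1) u = clifford_basis k u"
  by (simp add: clifford_def sum_axis_scaleR)

lemma F_plus_nth: "F_plus u $ k = clifford_basis k u"
  by (simp add: F_plus_def clifford_axis)

text \<open>Each row of \<open>omega_lo\<close> has a single nonzero entry, so the defining relation
  of \<open>omega_up\<close> isolates one of its entries up to sign.\<close>

lemma omega_up_entries:
  "omega_up $ i $ Inr b = (if i = Inl b then 1 else 0)"
  "omega_up $ i $ Inl b = (if i = Inr b then -1 else 0)"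
proof -
  have "(\<Sum>k\<in>UNIV. omega_lo $ Inl b $ k * omega_up $ i $ k) = omega_up $ i $ Inr b"
    "(\<Sum>k\<in>UNIV. omega_lo $ Inr b $ k * omega_up $ i $ k) = - omega_up $ i $ Inl b"
    by (simp_all add: sum_UNIV_Plus omega_lo_entries if_distrib[of "\<lambda>x. x * _"] cong: if_cong)
  then show "omega_up $ i $ Inr b = (if i = Inl b then 1 else 0)"
    and "omega_up $ i $ Inl b = (if i = Inr b then -1 else 0)"
    using omega_up[of "Inl b" i] omega_up[of "Inr b" i] by (auto split: if_splits)
qed

text \<open>For each \<open>j\<close> only the symplectic partner of \<open>j\<close> contributes to
  the sum over \<open>i\<close>. The resulting differences become commutators when
  \<open>F_minus\<close> is applied after \<open>F_plus\<close>.\<close>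

lemma F_minus_eq:
  "F_minus \<alpha> = - (\<Sum>a\<in>UNIV. clifford_basis (Inr a) (\<alpha> $ Inl a) - clifford_basis (Inl a) (\<alpha> $ Inr a))"
proof -
  have "(\<Sum>i\<in>UNIV. \<Sum>j\<in>UNIV. omega_up $ i $ j *\<^sub>R clifford (axis j 1) (\<alpha> $ i))
      = (\<Sum>j\<in>UNIV. \<Sum>i\<in>UNIV. omega_up $ i $ j *\<^sub>R clifford (axis j 1) (\<alpha> $ i))"
    by (rule sum.swap)
  also have "\<dots> = (\<Sum>b\<in>UNIV. - clifford_basis (Inl b) (\<alpha> $ Inr b)) + (\<Sum>b\<in>UNIV. clifford_basis (Inr b) (\<alpha> $ Inl b))"
    by (simp add: sum_UNIV_Plus[of "\<lambda>j. \<Sum>i\<in>UNIV. _ i j"] omega_up_entries clifford_axis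
        if_distrib[of "\<lambda>x. x *\<^sub>R _"] cong: if_cong)
  finally show ?thesis
    by (simp add: F_minus_def sum_subtractf sum_negf)
qed

lemma schwartz_space_F_minus: "\<alpha> \<in> schwartz_forms \<Longrightarrow> F_minus \<alpha> \<in> schwartz_space"
  unfolding F_minus_eq
  by (intro schwartz_space_uminus schwartz_space_sum schwartz_space_diff schwartz_space_clifford_basis)
    (auto simp: schwartz_forms_def)

lemma F_minus_diff:
  assumes "\<alpha> \<in> schwartz_forms" and "\<beta> \<in> schwartz_forms"
  shows "F_minus (\<alpha> - \<beta>) = F_minus \<alpha> - F_minus \<beta>"
  using assms by (simp add: F_minus_eq schwartz_forms_def clifford_basis_diff sum_subtractf)

lemma schwartz_forms_F_plus: "u \<in> schwartz_space \<Longrightarrow> F_plus u \<in> schwartz_forms"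
  by (simp add: schwartz_forms_def F_plus_nth schwartz_space_clifford_basis)

lemma schwartz_forms_diff: "\<alpha> \<in> schwartz_forms \<Longrightarrow> \<beta> \<in> schwartz_forms \<Longrightarrow> \<alpha> - \<beta> \<in> schwartz_forms"
  by (simp add: schwartz_forms_def schwartz_space_diff)

text \<open>Each of the \<open>CARD('l)\<close> conjugate pairs contributes the same
  commutator.\<close>

lemma F_minus_F_plus:
  fixes u :: "'l::finite L2"
  assumes "u \<in> schwartz_space"
  shows "F_minus (F_plus u) = (- (\<i> * of_nat CARD('l))) *\<^sub>C u"
proof -
  have "F_minus (F_plus u) = - (of_nat CARD('l) *\<^sub>R \<i> *\<^sub>C u)"
    by (simp add: F_minus_eq F_plus_nth clifford_basis_commutator[OF assms] sum_constant_scaleR)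
  then show ?thesis
    by (simp add: scaleR_eq_scaleC scaleC_scaleC mult.commute flip: scaleC_minus_one)
qed

text \<open>By \<open>F_minus_F_plus\<close>, the operator \<open>F_minus\<close> followed by
  multiplication with \<open>\<i> / of_nat CARD('l)\<close> is a left inverse of
  \<open>F_plus\<close> on the Schwartz space. This yields both the decomposition and its
  uniqueness.\<close>

lemma p10_eq:
  fixes \<alpha> :: "'l::finite L2^('l + 'l)"
  assumes "\<alpha> \<in> schwartz_forms"
  shows "p10 \<alpha> = F_plus ((\<i> / of_nat CARD('l)) *\<^sub>C F_minus \<alpha>)"
proof -
  let ?u = "(\<i> / of_nat CARD('l)) *\<^sub>C F_minus \<alpha>"
  have u: "?u \<in> schwartz_space"
    by (intro schwartz_space_scaleC schwartz_space_F_minus assms)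
  have "F_minus (F_plus ?u) = F_minus \<alpha>"
    by (simp add: F_minus_F_plus[OF u] scaleC_scaleC scaleC_one)
  then have "\<alpha> - F_plus ?u \<in> E11"
    by (simp add: E11_def schwartz_forms_diff schwartz_forms_F_plus u assms F_minus_diff)
  moreover have "\<beta> = F_plus ?u" if "\<beta> \<in> E10" "\<alpha> - \<beta> \<in> E11" for \<beta>
  proof -
    obtain w where w: "w \<in> schwartz_space" "\<beta> = F_plus w"
      using \<open>\<beta> \<in> E10\<close> by (auto simp: E10_def)
    \<comment> \<open>Any competitor is \<open>F_plus w\<close>, and applying the left inverse
      recovers \<open>w\<close> from \<open>F_minus \<alpha>\<close>.\<close>
    have "F_minus \<alpha> = F_minus \<beta>"
      using that F_minus_diff[OF assms schwartz_forms_F_plus[OF w(1)]] by (simp add: E11_def w)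
    then have "?u = w"
      by (simp add: w F_minus_F_plus scaleC_scaleC scaleC_one)
    then show ?thesis by (simp add: w)
  qed
  ultimately have "(THE \<beta>. \<beta> \<in> E10 \<and> \<alpha> - \<beta> \<in> E11) = F_plus ?u"
    using u by (intro the_equality) (auto simp: E10_def)
  then show ?thesis
    using assms by (simp add: p10_def)
qed

text \<open>Outside \<open>schwartz_forms\<close> the projection \<open>p10\<close> takes the junk value \<open>0\<close>, so there the left-hand
  side says \<open>\<alpha> = 0\<close>, which is impossible as \<open>0\<close> is a Schwartz form.\<close>

lemma twistor_part_eq_0_iff:
  fixes \<alpha> :: "'l::finite L2^('l + 'l)"
  shows "\<alpha> - p10 \<alpha> = 0 \<longleftrightarrow>
    \<alpha> \<in> schwartz_forms \<and> \<alpha> = F_plus ((\<i> / of_nat CARD('l)) *\<^sub>C F_minus \<alpha>)"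
proof (cases "\<alpha> \<in> schwartz_forms")
  case True
  then show ?thesis by (simp add: p10_eq)
next
  case False
  moreover have "0 \<in> schwartz_forms"
    by (simp add: schwartz_forms_def schwartz_space_0)
  ultimately show ?thesis by (auto simp: p10_def)
qed

text \<open>The argument is pointwise in \<open>q\<close>; the constants correspond by \<mu> =
  \<open>\<i> * of_nat CARD('l) * c\<close>, which does not involve \<open>q\<close>, so one
  constant serves all points.\<close>

lemma F_plus_eq_iff_twistor_dirac:
  fixes \<alpha> :: "'q \<Rightarrow> 'l::finite L2^('l + 'l)"
  assumes "\<And>q. \<phi> q \<in> schwartz_space"
  shows "(\<exists>c. \<forall>q. \<alpha> q = F_plus (c *\<^sub>C \<phi> q)) \<longleftrightarrow>
    (\<exists>\<mu>. \<forall>q. - F_minus (\<alpha> q) = \<mu> *\<^sub>C \<phi> q) \<and> (\<forall>q. \<alpha> q - p10 (\<alpha> q) = 0)"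
proof
  assume "\<exists>c. \<forall>q. \<alpha> q = F_plus (c *\<^sub>C \<phi> q)"
  then obtain c where c: "\<And>q. \<alpha> q = F_plus (c *\<^sub>C \<phi> q)" by blast
  have F: "F_minus (\<alpha> q) = (- (\<i> * of_nat CARD('l) * c)) *\<^sub>C \<phi> q" for q
    by (simp add: c F_minus_F_plus schwartz_space_scaleC assms scaleC_scaleC)
  then have "- F_minus (\<alpha> q) = (\<i> * of_nat CARD('l) * c) *\<^sub>C \<phi> q" for q
    by (simp add: scaleC_scaleC flip: scaleC_minus_one)
  moreover have "\<alpha> q - p10 (\<alpha> q) = 0" for q
    unfolding twistor_part_eq_0_iff F
    by (simp add: c schwartz_forms_F_plus schwartz_space_scaleC assms scaleC_scaleC)
  ultimately show "(\<exists>\<mu>. \<forall>q. - F_minus (\<alpha> q) = \<mu> *\<^sub>C \<phi> q) \<and> (\<forall>q. \<alpha> q - p10 (\<alpha> q) = 0)"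
    by blast
next
  assume "(\<exists>\<mu>. \<forall>q. - F_minus (\<alpha> q) = \<mu> *\<^sub>C \<phi> q) \<and> (\<forall>q. \<alpha> q - p10 (\<alpha> q) = 0)"
  then obtain \<mu> where \<mu>: "\<And>q. - F_minus (\<alpha> q) = \<mu> *\<^sub>C \<phi> q" and T: "\<And>q. \<alpha> q - p10 (\<alpha> q) = 0"
    by blast
  \<comment> \<open>The coefficient is the solution \<open>c\<close> of \<mu> =
    \<open>\<i> * of_nat CARD('l) * c\<close>.\<close>
  have "\<alpha> q = F_plus ((- \<i> * \<mu> / of_nat CARD('l)) *\<^sub>C \<phi> q)" for q
  proof -
    have "F_minus (\<alpha> q) = (- \<mu>) *\<^sub>C \<phi> q"
      using \<mu>[of q] scaleC_scaleC[of "-1" \<mu> "\<phi> q"] by (metis scaleC_minus_one minus_minus mult_minus1)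
    then have "(\<i> / of_nat CARD('l)) *\<^sub>C F_minus (\<alpha> q) = (- \<i> * \<mu> / of_nat CARD('l)) *\<^sub>C \<phi> q"
      by (simp add: scaleC_scaleC)
    then show ?thesis
      using T[of q] unfolding twistor_part_eq_0_iff by metis
  qed
  then show "\<exists>c. \<forall>q. \<alpha> q = F_plus (c *\<^sub>C \<phi> q)" by blast
qed

section \<open>The Killing equation in symplectic frames\<close>

text \<open>A frame pulls the form at \<open>x\<close> back to the nondegenerate form
  \<open>omega0\<close>, so it is injective and, being a square matrix, invertible.\<close>

lemma matrix_inv_mult_symplectic_frame:
  assumes "bilinear (\<omega> x)" and "(x, u) \<in> symplectic_frames \<omega>"
  shows "matrix_inv u ** u = mat 1"
proof -
  have "v = w" if "u *v v = u *v w" for v w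
  proof -
    have "\<omega> x (u *v (v - w)) (u *v z) = 0" for z
      using that bilinear_lzero[OF assms(1)] by (simp add: matrix_vector_mult_diff_distrib)
    then have omega: "omega0 (v - w) z = 0" for z
      using assms(2) by (simp add: symplectic_frames_def)
    \<comment> \<open>Pairing with the basis vector conjugate to index \<open>k\<close> isolates the
      coordinate \<open>k\<close> up to sign.\<close>
    have "(v - w) $ k = 0" for k
    proof (cases k)
      case (Inl i)
      then show ?thesis
        using omega[of "axis (Inr i) 1"]
        by (simp add: omega0_def axis_def if_distrib[of "\<lambda>x. _ * x"] cong: if_cong)
    next
      case (Inr i)
      then show ?thesis
        using omega[of "axis (Inl i) 1"]
        by (simp add: omega0_def axis_def sum_negf if_distrib[of "\<lambda>x. _ * x"] cong: if_cong)
    qed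
    then show ?thesis by (simp add: vec_eq_iff)
  qed
  then have "inj ((*v) u)" by (rule injI)
  then have "invertible u"
    using matrix_left_invertible_injective invertible_left_inverse by blast
  then show ?thesis
    unfolding invertible_def matrix_inv_def by (rule someI2_ex) blast
qed

text \<open>At each \<open>q\<close> the Killing equation is the combination of the components of
  the \<open>F_plus\<close> equation weighted by the frame coordinates of \<open>X\<close>. To
  recover a single component, \<open>X\<close> must be chosen with a coordinate vector as its frame
  coordinates at \<open>q\<close>.\<close>

lemma killing_equation_iff:
  fixes A :: "('m::{t2_space, second_countable_topology}, real^('l::finite + 'l)) chart set"
    and \<phi> :: "'q \<Rightarrow> 'l L2"
  assumes "symplectic_manifold A \<omega>" and "range Lam = symplectic_frames \<omega>"
    and "\<And>q. fst (Lam q) = proj q" and \<phi>: "\<And>q. \<phi> q \<in> schwartz_space"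
  shows "(\<forall>X\<in>vector_fields A. covariant_derivative A nabla AQ proj Lam X \<phi>
        = (\<lambda>q. c *\<^sub>C clifford_field proj Lam X \<phi> q)) \<longleftrightarrow>
    (\<forall>q. spinor_derivative A nabla AQ proj Lam \<phi> q = F_plus (c *\<^sub>C \<phi> q))"
proof
  let ?s = "spinor_derivative A nabla AQ proj Lam \<phi>"
  assume K: "\<forall>X\<in>vector_fields A. covariant_derivative A nabla AQ proj Lam X \<phi>
      = (\<lambda>q. c *\<^sub>C clifford_field proj Lam X \<phi> q)"
  show "\<forall>q. ?s q = F_plus (c *\<^sub>C \<phi> q)"
  proof (intro allI, subst vec_eq_iff, intro allI)
    fix q k
    have "smooth_manifold A"
      using assms(1) by (simp add: symplectic_manifold_def)
    \<comment> \<open>The prescribed value is the frame vector with index \<open>k\<close>, so that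
      \<open>X\<close> has frame coordinates \<open>axis k 1\<close> at \<open>q\<close>.\<close>
    then obtain X where X: "X \<in> vector_fields A" "X (proj q) = snd (Lam q) *v axis k 1"
      by (rule exists_vector_field)
    have "matrix_inv (snd (Lam q)) ** snd (Lam q) = mat 1"
    proof (rule matrix_inv_mult_symplectic_frame)
      show "bilinear (\<omega> (proj q))"
        using assms(1) by (simp add: symplectic_manifold_def)
      show "(proj q, snd (Lam q)) \<in> symplectic_frames \<omega>"
        using assms(2,3) by (metis prod.collapse rangeI)
    qed
    then have coords: "frame_coords proj Lam X q = axis k 1"
      by (simp add: frame_coords_def X(2) matrix_vector_mul_assoc)
    have "covariant_derivative A nabla AQ proj Lam X \<phi> q = c *\<^sub>C clifford_field proj Lam X \<phi> q"
      using K X(1) by metis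
    then show "?s q $ k = F_plus (c *\<^sub>C \<phi> q) $ k"
      by (simp add: covariant_derivative_def clifford_field_def coords sum_axis_scaleR clifford_axis
          F_plus_nth clifford_basis_scaleC \<phi>)
  qed
next
  \<comment> \<open>Clifford multiplication by \<open>X\<close> expands over the basis with the same
    frame coordinates as the covariant derivative, and complex scaling passes through the
    sum.\<close>
  assume "\<forall>q. spinor_derivative A nabla AQ proj Lam \<phi> q = F_plus (c *\<^sub>C \<phi> q)"
  then show "\<forall>X\<in>vector_fields A. covariant_derivative A nabla AQ proj Lam X \<phi>
      = (\<lambda>q. c *\<^sub>C clifford_field proj Lam X \<phi> q)"
    by (simp add: covariant_derivative_def clifford_field_def clifford_def F_plus_nth
        clifford_basis_scaleC \<phi> linear_sum[OF linear_scaleC] linear_cmul[OF linear_scaleC])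
qed

theorem theorem6:
  fixes A :: "('m::{t2_space, second_countable_topology}, real^('l::finite + 'l)) chart set"
    and \<omega> :: "'m \<Rightarrow> real^('l + 'l) \<Rightarrow> real^('l + 'l) \<Rightarrow> real"
    and nabla :: "('m \<Rightarrow> real^('l + 'l)) \<Rightarrow> ('m \<Rightarrow> real^('l + 'l)) \<Rightarrow> 'm \<Rightarrow> real^('l + 'l)"
    and G :: "'g::{t2_space, second_countable_topology} monoid"
    and AG :: "('g, 'h::euclidean_space) chart set"
    and \<kappa> :: "'g \<Rightarrow> real^('l + 'l)^('l + 'l)"
    and L :: "'g \<Rightarrow> 'l L2 \<Rightarrow> 'l L2"
    and AQ :: "('q::{t2_space, second_countable_topology}, 'k::euclidean_space) chart set"
    and proj :: "'q \<Rightarrow> 'm"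
    and act :: "'q \<Rightarrow> 'g \<Rightarrow> 'q"
    and Lam :: "'q \<Rightarrow> 'm \<times> (real^('l + 'l)^('l + 'l))"
    and \<phi> :: "'q \<Rightarrow> 'l L2"
  assumes "fedosov_manifold A \<omega> nabla"
    and "metaplectic_group G AG \<kappa>"
    and "segal_shale_weil G \<kappa> L"
    and "metaplectic_structure A \<omega> G AG \<kappa> AQ proj act Lam"
    and "\<phi> \<in> spinor_fields G L AQ act"
  shows "symplectic_killing_spinor A nabla AQ proj Lam \<phi> \<longleftrightarrow>
    symplectic_dirac_spinor A nabla AQ proj Lam \<phi> \<and>
    symplectic_twistor A nabla AQ proj Lam \<phi> = (\<lambda>q. 0)"
proof -
  have \<phi>: "\<And>q. \<phi> q \<in> schwartz_space"
    using assms(5) by (simp add: spinor_fields_def)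
  have "symplectic_manifold A \<omega>"
    using assms(1) by (simp add: fedosov_manifold_def)
  moreover have "range Lam = symplectic_frames \<omega>" "\<And>q. fst (Lam q) = proj q"
    using assms(4) by (simp_all add: metaplectic_structure_def)
  ultimately have "symplectic_killing_spinor A nabla AQ proj Lam \<phi> \<longleftrightarrow> \<phi> \<noteq> (\<lambda>q. 0) \<and>
      (\<exists>c. \<forall>q. spinor_derivative A nabla AQ proj Lam \<phi> q = F_plus (c *\<^sub>C \<phi> q))"
    unfolding symplectic_killing_spinor_def by (simp only: killing_equation_iff \<phi>)
  then show ?thesis
    \<comment> \<open>The condition that \<phi> is nonzero occurs on both sides; the remaining
      equivalence is applied to the function
      \<open>spinor_derivative A nabla AQ proj Lam \<phi>\<close>.\<close>
    unfolding F_plus_eq_iff_twistor_dirac[of \<phi>, OF \<phi>] symplectic_dirac_spinor_def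
      symplectic_dirac_def symplectic_twistor_def fun_eq_iff
    by blast
qed

end
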